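(* Let $M$ be a perfect matroid design of rank $k\in[n-1]$ on a ground set $E$ with $n=|E|$, with no loops and no coloops. Then: (a) $\{d_i(M)\}_{i=1}^{n-k}$ is subadditive and cosubadditive. (b) For any $s=(n-k)q+r$ with $r\in[n-k]$ and $q\in\mathbb{Z}_{\ge0}$, $\alpha(I_{\Delta(M)}^{(s)})=qd_{n-k}(M)+d_r(M)=qn+d_r(M)$. In particular, $\widehat{\alpha}(I_{\Delta(M)})=\frac{n}{n-k}$. (c) For any $s=kq+r$ with $r\in[k]$ and $q\in\mathbb{Z}_{\ge0}$, $\alpha(I_{\Delta(M^* )}^{(s)})=qd_k(M^* )+d_r(M^* )=qn+d_r(M^* )$. In particular, $\widehat{\alpha}(I_{\Delta(M^* )})=\frac{n}{k}$.
   Context: $[m]=\{1,\dots,m\}$. A matroid of rank $k$ is a perfect matroid design if for each $i\in[k]$ all flats of rank $i$ have the same cardinality. $M^*$ is the dual matroid. For a matroid $N$ of rank $\rho$ on $E$ and $r\in[n-\rho]$, $d_r(N)=\min\{|U|: U\subseteq E,\ |U|-\mathrm{rk}_N(U)=r\}$ is the $r$-th generalized Hamming weight. A sequence $\{e_i\}_{i=1}^m$ is subadditive if $e_{i+j}\le e_i+e_j$ whenever $i,j,i+j\in[m]$; $\{d_i(M)\}_{i=1}^{n-k}$ is cosubadditive if its Wei dual, i.e. the sequence listing $[n]\setminus\{n+1-d_j(M): j\in[n-k]\}$ in increasing order (equivalently $\{d_i(M^* )\}_{i=1}^k$), is subadditive. Let $S=\mathbb{L}[x_e: e\in E]$, $\mathbb{L}$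 a field. $I_{\Delta(N)}=\langle\prod_{e\in C}x_e: C\text{ a circuit of }N\rangle$ is the Stanley-Reisner ideal of the independence complex of $N$, with symbolic powers $I_{\Delta(N)}^{(s)}=\bigcap_{B\in\mathcal{B}(N^* )}\langle x_e: e\in B\rangle^s$, where $\mathcal{B}(N^* )$ is the set of bases of $N^*$. $\alpha(I)$ is the smallest degree of a nonzero homogeneous element of $I$, and $\widehat{\alpha}(I)=\lim_{s\to\infty}\alpha(I^{(s)})/s$. *)

theory Defs
  imports
    Complex_Main
    "HOL-Algebra.Ideal_Product"
    "HOL-Library.Poly_Mapping"
begin

section \<open>Matroids\<close>

locale matroid =
  fixes E :: "'e set" and indep :: "'e set \<Rightarrow> bool"
  assumes finite_ground: "finite E"
    and indep_subset_ground: "indep X \<Longrightarrow> X \<subseteq> E"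
    and indep_empty: "indep {}"
    and indep_mono: "indep X \<Longrightarrow> Y \<subseteq> X \<Longrightarrow> indep Y"
    and augment: "indep X \<Longrightarrow> indep Y \<Longrightarrow> card X < card Y \<Longrightarrow> \<exists>e\<in>Y - X. indep (insert e X)"

definition matroid_rank :: "('e set \<Rightarrow> bool) \<Rightarrow> 'e set \<Rightarrow> nat" where
  "matroid_rank indep X = Max {card Y | Y. Y \<subseteq> X \<and> indep Y}"

definition matroid_basis :: "('e set \<Rightarrow> bool) \<Rightarrow> 'e set \<Rightarrow> bool" where
  "matroid_basis indep B \<longleftrightarrow> indep B \<and> (\<forall>X. indep X \<and> B \<subseteq> X \<longrightarrow> X = B)"

definition matroid_circuit :: "'e set \<Rightarrow> ('e set \<Rightarrow> bool) \<Rightarrow> 'e set \<Rightarrow> bool" where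
  "matroid_circuit E indep C \<longleftrightarrow> C \<subseteq> E \<and> \<not> indep C \<and> (\<forall>X. X \<subset> C \<longrightarrow> indep X)"

definition matroid_flat :: "'e set \<Rightarrow> ('e set \<Rightarrow> bool) \<Rightarrow> 'e set \<Rightarrow> bool" where
  "matroid_flat E indep F \<longleftrightarrow>
     F \<subseteq> E \<and> (\<forall>e\<in>E - F. matroid_rank indep F < matroid_rank indep (insert e F))"

definition matroid_loop :: "'e set \<Rightarrow> ('e set \<Rightarrow> bool) \<Rightarrow> 'e \<Rightarrow> bool" where
  "matroid_loop E indep e \<longleftrightarrow> e \<in> E \<and> \<not> indep {e}"

definition matroid_coloop :: "'e set \<Rightarrow> ('e set \<Rightarrow> bool) \<Rightarrow> 'e \<Rightarrow> bool" where
  "matroid_coloop E indep e \<longleftrightarrow> e \<in> E \<and> (\<forall>B. matroid_basis indep B \<longrightarrow> e \<in> B)"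

definition matroid_dual :: "'e set \<Rightarrow> ('e set \<Rightarrow> bool) \<Rightarrow> 'e set \<Rightarrow> bool" where
  "matroid_dual E indep X \<longleftrightarrow> X \<subseteq> E \<and> (\<exists>B. matroid_basis indep B \<and> X \<inter> B = {})"

definition perfect_matroid_design :: "'e set \<Rightarrow> ('e set \<Rightarrow> bool) \<Rightarrow> bool" where
  "perfect_matroid_design E indep \<longleftrightarrow> matroid E indep \<and>
     (\<forall>i\<in>{1..matroid_rank indep E}. \<forall>F G.
        matroid_flat E indep F \<and> matroid_rank indep F = i \<and>
        matroid_flat E indep G \<and> matroid_rank indep G = i \<longrightarrow> card F = card G)"

text \<open>The subtraction of naturals never truncates, since the rank of a set is at most its size.\<close>

definition gen_hamming_weight :: "'e set \<Rightarrow> ('e set \<Rightarrow> bool) \<Rightarrow> nat \<Rightarrow> nat" where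
  "gen_hamming_weight E indep r = Min {card U | U. U \<subseteq> E \<and> card U - matroid_rank indep U = r}"


section \<open>Subadditive sequences\<close>

text \<open>A finite sequence indexed by \<open>1, \<dots>, m\<close> is a function on \<^typ>\<open>nat\<close> together with \<open>m\<close>.\<close>

definition subadditive :: "nat \<Rightarrow> (nat \<Rightarrow> nat) \<Rightarrow> bool" where
  "subadditive m e \<longleftrightarrow>
     (\<forall>i\<in>{1..m}. \<forall>j\<in>{1..m}. i + j \<in> {1..m} \<longrightarrow> e (i + j) \<le> e i + e j)"

definition wei_dual :: "nat \<Rightarrow> nat \<Rightarrow> (nat \<Rightarrow> nat) \<Rightarrow> nat list" where
  "wei_dual n m d = sorted_list_of_set ({1..n} - {n + 1 - d j | j. j \<in> {1..m}})"

text \<open>List positions start at 0, so the \<open>i\<close>-th term of the Wei dual is at position \<open>i - 1\<close>.\<close>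

definition cosubadditive :: "nat \<Rightarrow> nat \<Rightarrow> (nat \<Rightarrow> nat) \<Rightarrow> bool" where
  "cosubadditive n m d \<longleftrightarrow> subadditive (length (wei_dual n m d)) (\<lambda>i. wei_dual n m d ! (i - 1))"


section \<open>Polynomials and ideals\<close>

text \<open>A monomial is its finitely supported exponent function, a polynomial is the finitely
  supported function of its coefficients; multiplication on \<open>\<Rightarrow>\<^sub>0\<close> is convolution.\<close>

type_synonym ('e, 'l) mpoly = "('e \<Rightarrow>\<^sub>0 nat) \<Rightarrow>\<^sub>0 'l"

definition mpoly_ring :: "'e set \<Rightarrow> ('e, 'l::field) mpoly ring" where
  "mpoly_ring E = \<lparr>carrier = {p. \<forall>m\<in>Poly_Mapping.keys p. Poly_Mapping.keys m \<subseteq> E}, mult = (*), one = 1, zero = 0, add = (+)\<rparr>"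

definition mpoly_var :: "'e \<Rightarrow> ('e, 'l::field) mpoly" where
  "mpoly_var e = Poly_Mapping.single (Poly_Mapping.single e 1) 1"

definition homogeneous :: "nat \<Rightarrow> ('e, 'l::field) mpoly \<Rightarrow> bool" where
  "homogeneous d p \<longleftrightarrow> (\<forall>m\<in>Poly_Mapping.keys p. (\<Sum>e\<in>Poly_Mapping.keys m. Poly_Mapping.lookup m e) = d)"

definition initial_degree :: "('e, 'l::field) mpoly set \<Rightarrow> nat" where
  "initial_degree I = (LEAST d. \<exists>p\<in>I. p \<noteq> 0 \<and> homogeneous d p)"

definition stanley_reisner_ideal :: "'e set \<Rightarrow> ('e set \<Rightarrow> bool) \<Rightarrow> ('e, 'l::field) mpoly set" where
  "stanley_reisner_ideal E indep =
     Idl\<^bsub>mpoly_ring E\<^esub> {\<Prod>e\<in>C. mpoly_var e | C. matroid_circuit E indep C}"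

text \<open>The \<open>s\<close>-th symbolic power of the Stanley-Reisner ideal is the intersection of the \<open>s\<close>-th
  powers of its minimal primes, which are generated by the variables of the bases of the dual
  matroid. Powers are taken in the multiplicative monoid of ideals; the zeroth power is the whole
  ring. Lemma \<open>sr_symbolic_power_one\<close> below connects the definition to the ideal itself.\<close>

definition sr_symbolic_power ::
    "'e set \<Rightarrow> ('e set \<Rightarrow> bool) \<Rightarrow> nat \<Rightarrow> ('e, 'l::field) mpoly set" where
  "sr_symbolic_power E indep s =
     (\<Inter>B\<in>{B. matroid_basis (matroid_dual E indep) B}.
        (Idl\<^bsub>mpoly_ring E\<^esub> (mpoly_var ` B)) [^]\<^bsub>ideals_set (mpoly_ring E)\<^esub> s)"

section \<open>The first symbolic power is the Stanley-Reisner ideal\<close>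

lemma mpoly_ring_cring: "cring (mpoly_ring E :: ('e, 'l::field) mpoly ring)"
proof (rule cringI)
  let ?R = "mpoly_ring E :: ('e, 'l) mpoly ring"
  have neg: "- p \<in> carrier ?R" if "p \<in> carrier ?R" for p
    using that by (auto simp: mpoly_ring_def)
  show "abelian_group ?R"
  proof (rule abelian_groupI)
    fix x y :: "('e, 'l) mpoly" assume "x \<in> carrier ?R" "y \<in> carrier ?R"
    then show "x \<oplus>\<^bsub>?R\<^esub> y \<in> carrier ?R"
      using Poly_Mapping.keys_add[of x y] by (force simp: mpoly_ring_def)
  next
    fix x :: "('e, 'l) mpoly" assume "x \<in> carrier ?R"
    then show "\<exists>y\<in>carrier ?R. y \<oplus>\<^bsub>?R\<^esub> x = \<zero>\<^bsub>?R\<^esub>"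
      using neg by (intro bexI[of _ "- x"]) (auto simp: mpoly_ring_def)
  qed (auto simp: mpoly_ring_def algebra_simps)
  show "Group.comm_monoid ?R"
  proof (rule comm_monoidI)
    fix x y :: "('e, 'l) mpoly" assume xy: "x \<in> carrier ?R" "y \<in> carrier ?R"
    have "Poly_Mapping.keys m \<subseteq> E" if "m \<in> Poly_Mapping.keys (x * y)" for m
    proof -
      from that keys_mult[of x y] obtain a b where "m = a + b" "a \<in> Poly_Mapping.keys x" "b \<in> Poly_Mapping.keys y"
        by blast
      then have "Poly_Mapping.keys a \<subseteq> E" "Poly_Mapping.keys b \<subseteq> E"
        using xy by (auto simp: mpoly_ring_def)
      with \<open>m = a + b\<close> Poly_Mapping.keys_add[of a b] show ?thesis by blast
    qed
    then show "x \<otimes>\<^bsub>?R\<^esub> y \<in> carrier ?R" by (auto simp: mpoly_ring_def)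
  qed (auto simp: mpoly_ring_def algebra_simps)
qed (auto simp: mpoly_ring_def algebra_simps)

lemma monomial_ideal_eq:
  fixes E :: "'e set" and G :: "('e \<Rightarrow>\<^sub>0 nat) set"
  assumes G: "\<And>g. g \<in> G \<Longrightarrow> Poly_Mapping.keys g \<subseteq> E"
  shows "Idl\<^bsub>mpoly_ring E\<^esub> ((\<lambda>g. Poly_Mapping.single g (1::'l::field)) ` G) =
    {p. \<forall>m\<in>Poly_Mapping.keys p. Poly_Mapping.keys m \<subseteq> E \<and> (\<exists>g\<in>G. \<exists>h. m = g + h)}" (is "?L = ?M")
proof -
  let ?R = "mpoly_ring E :: ('e, 'l) mpoly ring"
  interpret R: cring ?R by (rule mpoly_ring_cring)
  let ?S = "(\<lambda>g. Poly_Mapping.single g (1::'l)) ` G"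
  have S: "?S \<subseteq> carrier ?R" using G by (fastforce simp: mpoly_ring_def)
  have mult: "x * a \<in> ?M" if a: "a \<in> ?M" and x: "x \<in> carrier ?R" for a x
  proof -
    have "Poly_Mapping.keys m \<subseteq> E \<and> (\<exists>g\<in>G. \<exists>h. m = g + h)" if m: "m \<in> Poly_Mapping.keys (x * a)" for m
    proof -
      from m keys_mult[of x a] obtain u v where uv: "m = u + v" "u \<in> Poly_Mapping.keys x" "v \<in> Poly_Mapping.keys a"
        by blast
      with a obtain g h where gh: "g \<in> G" "v = g + h" by blast
      have "m = g + (u + h)" using uv gh by (simp add: algebra_simps)
      moreover have "Poly_Mapping.keys m \<subseteq> E"
      proof -
        have "Poly_Mapping.keys u \<subseteq> E" "Poly_Mapping.keys v \<subseteq> E"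
          using uv a x by (auto simp: mpoly_ring_def)
        with uv Poly_Mapping.keys_add[of u v] show ?thesis by blast
      qed
      ultimately show ?thesis using gh by blast
    qed
    then show ?thesis by blast
  qed
  have idM: "ideal ?M ?R"
  proof (rule idealI)
    show "ring ?R" by (rule R.ring_axioms)
    have neg: "\<ominus>\<^bsub>?R\<^esub> p = - p" if "p \<in> carrier ?R" for p
      by (rule R.minus_equality) (use that in \<open>auto simp: mpoly_ring_def\<close>)
    have inv: "inv\<^bsub>add_monoid ?R\<^esub> p = - p" if "p \<in> carrier ?R" for p
      using neg[OF that] by (simp add: a_inv_def)
    show "subgroup ?M (add_monoid ?R)"
    proof (rule subgroup.intro)
      show "?M \<subseteq> carrier (add_monoid ?R)" by (auto simp: mpoly_ring_def)
      fix x y assume xy: "x \<in> ?M" "y \<in> ?M"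
      show "x \<otimes>\<^bsub>add_monoid ?R\<^esub> y \<in> ?M"
        using xy Poly_Mapping.keys_add[of x y] by (simp add: mpoly_ring_def) blast
      have "x \<in> carrier ?R" using xy by (auto simp: mpoly_ring_def)
      then show "inv\<^bsub>add_monoid ?R\<^esub> x \<in> ?M" using inv xy by simp
    qed (auto simp: mpoly_ring_def)
    fix a x assume ax: "a \<in> ?M" "x \<in> carrier ?R"
    show "x \<otimes>\<^bsub>?R\<^esub> a \<in> ?M" using mult[OF ax] by (simp add: mpoly_ring_def)
    show "a \<otimes>\<^bsub>?R\<^esub> x \<in> ?M" using mult[OF ax] by (simp add: mpoly_ring_def mult.commute)
  qed
  have "?S \<subseteq> ?M"
  proof (intro subsetI)
    fix p assume "p \<in> ?S"
    then obtain g where g: "g \<in> G" "p = Poly_Mapping.single g 1" by blast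
    have "g = g + 0" by simp
    then have "\<exists>g'\<in>G. \<exists>h. g = g' + h" using g by blast
    with g G[of g] show "p \<in> ?M" by auto
  qed
  then have "?L \<subseteq> ?M" by (rule R.genideal_minimal[OF idM])
  moreover have "?M \<subseteq> ?L"
  proof
    interpret I: ideal ?L ?R by (rule R.genideal_ideal[OF S])
    fix p assume p: "p \<in> ?M"
    have trm: "Poly_Mapping.single m (Poly_Mapping.lookup p m) \<in> ?L" if m: "m \<in> Poly_Mapping.keys p" for m
    proof -
      from m p obtain g h where gh: "g \<in> G" "m = g + h" "Poly_Mapping.keys m \<subseteq> E" by blast
      have "Poly_Mapping.keys h \<subseteq> Poly_Mapping.keys m" using gh
        by (auto simp: in_keys_iff lookup_add)
      then have "Poly_Mapping.single h (Poly_Mapping.lookup p m) \<in> carrier ?R"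
        using gh by (auto simp: mpoly_ring_def)
      moreover have "Poly_Mapping.single g 1 \<in> ?L"
        using R.genideal_self[OF S] gh by blast
      ultimately have "Poly_Mapping.single g 1 \<otimes>\<^bsub>?R\<^esub> Poly_Mapping.single h (Poly_Mapping.lookup p m) \<in> ?L"
        by (rule I.I_r_closed[rotated])
      then show ?thesis using gh by (simp add: mpoly_ring_def mult_single)
    qed
    have sums: "(\<Sum>m\<in>A. Poly_Mapping.single m (Poly_Mapping.lookup p m)) \<in> ?L"
      if "finite A" "A \<subseteq> Poly_Mapping.keys p" for A
      using that
    proof (induction A rule: finite_induct)
      case empty
      show ?case using I.zero_closed by (simp add: mpoly_ring_def)
    next
      case (insert m A)
      then show ?case using I.a_closed[OF trm[of m], of "\<Sum>m\<in>A. Poly_Mapping.single m (Poly_Mapping.lookup p m)"]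
        by (simp add: mpoly_ring_def)
    qed
    have "p = (\<Sum>m\<in>Poly_Mapping.keys p. Poly_Mapping.single m (Poly_Mapping.lookup p m))"
      by (rule poly_mapping_eqI) (simp add: lookup_sum lookup_single when_def in_keys_iff)
    then show "p \<in> ?L" using sums[of "Poly_Mapping.keys p"] by simp
  qed
  ultimately show ?thesis by blast
qed

lemma (in matroid) finite_indep: "indep X \<Longrightarrow> finite X"
  using indep_subset_ground finite_ground finite_subset by blast

lemma (in matroid) basis_extends:
  assumes "indep X" shows "\<exists>B. matroid_basis indep B \<and> X \<subseteq> B"
proof -
  have fin: "finite {Y. indep Y \<and> X \<subseteq> Y}"
    by (rule finite_subset[of _ "Pow E"]) (use indep_subset_ground finite_ground in auto)
  then obtain B where "B \<in> {Y. indep Y \<and> X \<subseteq> Y}" "\<forall>Y\<in>{Y. indep Y \<and> X \<subseteq> Y}. B \<subseteq> Y \<longrightarrow> B = Y"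
    using finite_has_maximal[OF fin] assms by auto
  then show ?thesis unfolding matroid_basis_def by blast
qed

lemma (in matroid) basis_card_eq:
  assumes "matroid_basis indep B" "matroid_basis indep B'"
  shows "card B = card B'"
proof -
  have "\<not> card X < card Y" if XY: "matroid_basis indep X" "matroid_basis indep Y" for X Y
  proof
    assume "card X < card Y"
    then obtain e where "e \<in> Y - X" "indep (insert e X)"
      using augment XY unfolding matroid_basis_def by blast
    then show False using XY unfolding matroid_basis_def by blast
  qed
  from this[OF assms] this[OF assms(2,1)] show ?thesis by simp
qed

lemma (in matroid) dual_basis_iff:
  "matroid_basis (matroid_dual E indep) X \<longleftrightarrow> (\<exists>B. matroid_basis indep B \<and> X = E - B)"
proof
  assume X: "matroid_basis (matroid_dual E indep) X"
  then obtain B where B: "X \<subseteq> E" "matroid_basis indep B" "X \<inter> B = {}"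
    unfolding matroid_basis_def matroid_dual_def by blast
  have "matroid_dual E indep (E - B)" using B unfolding matroid_dual_def by blast
  moreover have "X \<subseteq> E - B" using B by blast
  ultimately have "E - B = X" using X unfolding matroid_basis_def by blast
  then show "\<exists>B. matroid_basis indep B \<and> X = E - B" using B by blast
next
  assume "\<exists>B. matroid_basis indep B \<and> X = E - B"
  then obtain B where B: "matroid_basis indep B" "X = E - B" by blast
  have BE: "B \<subseteq> E" using B indep_subset_ground unfolding matroid_basis_def by blast
  have "Y = X" if Y: "matroid_dual E indep Y" "X \<subseteq> Y" for Y
  proof -
    obtain B' where B': "matroid_basis indep B'" "Y \<inter> B' = {}" "Y \<subseteq> E"
      using Y unfolding matroid_dual_def by blast
    have "B' \<subseteq> E" using B' indep_subset_ground unfolding matroid_basis_def by blast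
    then have sub: "B' \<subseteq> B" using Y B B' by blast
    then have "B' = B"
      using B B' unfolding matroid_basis_def by blast
    then show ?thesis using Y B B' by blast
  qed
  moreover have "matroid_dual E indep X" using B unfolding matroid_dual_def by blast
  ultimately show "matroid_basis (matroid_dual E indep) X" unfolding matroid_basis_def by blast
qed

lemma (in matroid) dependent_contains_circuit:
  assumes "D \<subseteq> E" "\<not> indep D" shows "\<exists>C. matroid_circuit E indep C \<and> C \<subseteq> D"
proof -
  let ?P = "\<lambda>C. C \<subseteq> D \<and> \<not> indep C"
  define C where "C = arg_min card ?P"
  have C: "C \<subseteq> D" "\<not> indep C"
    using arg_min_natI[of ?P D card] assms unfolding C_def by simp_all
  have fin: "finite C" using C(1) assms(1) finite_ground by (meson finite_subset)
  have "indep X" if X: "X \<subset> C" for X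
  proof (rule ccontr)
    assume "\<not> indep X"
    moreover have "X \<subseteq> D" using X C(1) by (meson order.strict_implies_order order_trans)
    ultimately have "card C \<le> card X"
      unfolding C_def by (intro arg_min_nat_le conjI)
    moreover have "card X < card C" using fin X by (rule psubset_card_mono)
    ultimately show False by simp
  qed
  moreover have "C \<subseteq> E" using C(1) assms(1) by (rule order_trans)
  ultimately have "matroid_circuit E indep C" using C(2) by (simp add: matroid_circuit_def)
  then show ?thesis using C(1) by (intro exI conjI)
qed

lemma sr_symbolic_power_one:
  fixes E :: "'e set"
  assumes "matroid E indep"
  shows "sr_symbolic_power E indep 1 = (stanley_reisner_ideal E indep :: ('e, 'l::field) mpoly set)"
proof -
  interpret matroid E indep by fact
  let ?R = "mpoly_ring E :: ('e, 'l) mpoly ring"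
  interpret R: cring ?R by (rule mpoly_ring_cring)
  let ?X = "\<lambda>C::'e set. \<Sum>e\<in>C. Poly_Mapping.single e (Suc 0)"
  have lX: "Poly_Mapping.lookup (?X C) e = (if e \<in> C then 1 else 0)" if "finite C" for C e
    using that by (simp add: lookup_sum lookup_single when_def)
  have kX: "Poly_Mapping.keys (?X C) = C" if "finite C" for C
    using lX[OF that] by (auto simp: in_keys_iff split: if_splits)
  have dvd: "(\<exists>h. m = ?X C + h) \<longleftrightarrow> C \<subseteq> Poly_Mapping.keys m" if C: "finite C" for C m
  proof
    assume "\<exists>h. m = ?X C + h"
    then show "C \<subseteq> Poly_Mapping.keys m" using lX[OF C] by (auto simp: in_keys_iff lookup_add)
  next
    assume s: "C \<subseteq> Poly_Mapping.keys m"
    have "m = ?X C + (m - ?X C)"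
    proof (rule poly_mapping_eqI)
      fix e
      have "e \<in> C \<Longrightarrow> Poly_Mapping.lookup m e \<noteq> 0" using s by (auto simp: in_keys_iff)
      then show "Poly_Mapping.lookup m e = Poly_Mapping.lookup (?X C + (m - ?X C)) e"
        by (simp add: lookup_add minus_poly_mapping.rep_eq lX[OF C])
    qed
    then show "\<exists>h. m = ?X C + h" by blast
  qed
  have circ_fin: "finite C" "C \<subseteq> E" if "matroid_circuit E indep C" for C
    using that finite_ground unfolding matroid_circuit_def by (auto intro: finite_subset)
  have X: "(\<Prod>e\<in>C. mpoly_var e) = Poly_Mapping.single (?X C) (1::'l)" if "finite C" for C
    using that by (induction C rule: finite_induct) (simp_all add: mpoly_var_def mult_single)
  have "{\<Prod>e\<in>C. mpoly_var e | C. matroid_circuit E indep C} =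
      (\<lambda>g. Poly_Mapping.single g (1::'l)) ` (?X ` {C. matroid_circuit E indep C})"
    (is "?P = ?Q")
  proof (intro equalityI subsetI)
    fix p assume "p \<in> ?P"
    then obtain C where "matroid_circuit E indep C" "p = (\<Prod>e\<in>C. mpoly_var e)" by blast
    then show "p \<in> ?Q" using X[OF circ_fin(1)[of C]] by (metis (mono_tags) imageI mem_Collect_eq)
  next
    fix p assume "p \<in> ?Q"
    then obtain C where "matroid_circuit E indep C" "p = Poly_Mapping.single (?X C) 1" by blast
    then show "p \<in> ?P" using X[OF circ_fin(1)[of C]] by (metis (mono_tags) mem_Collect_eq)
  qed
  moreover have "Idl\<^bsub>?R\<^esub> ((\<lambda>g. Poly_Mapping.single g 1) ` (?X ` {C. matroid_circuit E indep C})) =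
      {p. \<forall>m\<in>Poly_Mapping.keys p. Poly_Mapping.keys m \<subseteq> E \<and>
        (\<exists>g\<in>?X ` {C. matroid_circuit E indep C}. \<exists>h. m = g + h)}"
  proof (rule monomial_ideal_eq)
    fix g assume "g \<in> ?X ` {C. matroid_circuit E indep C}"
    then obtain C where C: "matroid_circuit E indep C" "g = ?X C" by blast
    show "Poly_Mapping.keys g \<subseteq> E"
      unfolding C(2) kX[OF circ_fin(1)[OF C(1)]] by (rule circ_fin(2)[OF C(1)])
  qed
  ultimately have SR: "(stanley_reisner_ideal E indep :: ('e, 'l) mpoly set) =
      {p. \<forall>m\<in>Poly_Mapping.keys p. Poly_Mapping.keys m \<subseteq> E \<and>
        (\<exists>C. matroid_circuit E indep C \<and> C \<subseteq> Poly_Mapping.keys m)}"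
    unfolding stanley_reisner_ideal_def using dvd[OF circ_fin(1)] by (simp cong: conj_cong)
  have lin: "Idl\<^bsub>?R\<^esub> (mpoly_var ` B) =
      {p. \<forall>m\<in>Poly_Mapping.keys p. Poly_Mapping.keys m \<subseteq> E \<and> Poly_Mapping.keys m \<inter> B \<noteq> {}}"
    if "B \<subseteq> E" for B
  proof -
    have eq: "(mpoly_var ` B :: ('e, 'l) mpoly set) =
        (\<lambda>g. Poly_Mapping.single g (1::'l)) ` ((\<lambda>b. ?X {b}) ` B)"
      by (auto simp: mpoly_var_def)
    have "Idl\<^bsub>?R\<^esub> (mpoly_var ` B) =
        {p. \<forall>m\<in>Poly_Mapping.keys p. Poly_Mapping.keys m \<subseteq> E \<and> (\<exists>g\<in>(\<lambda>b. ?X {b}) ` B. \<exists>h. m = g + h)}"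
      unfolding eq by (rule monomial_ideal_eq) (use that in auto)
    also have "\<dots> = {p. \<forall>m\<in>Poly_Mapping.keys p. Poly_Mapping.keys m \<subseteq> E \<and> Poly_Mapping.keys m \<inter> B \<noteq> {}}"
      using dvd[of "{_}"] by auto
    finally show ?thesis .
  qed
  have pow1: "(Idl\<^bsub>?R\<^esub> (mpoly_var ` B)) [^]\<^bsub>ideals_set ?R\<^esub> (1::nat) = Idl\<^bsub>?R\<^esub> (mpoly_var ` B)"
    if "B \<subseteq> E" for B
  proof -
    interpret M: Group.comm_monoid "ideals_set ?R" by (rule R.ideals_set_is_comm_monoid)
    have "ideal (Idl\<^bsub>?R\<^esub> (mpoly_var ` B)) ?R"
      by (rule R.genideal_ideal) (use that in \<open>auto simp: mpoly_ring_def mpoly_var_def\<close>)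
    then have "Idl\<^bsub>?R\<^esub> (mpoly_var ` B) \<in> carrier (ideals_set ?R)" by (simp add: ideals_set_def)
    then show ?thesis by simp
  qed
  have dualE: "B \<subseteq> E" if "matroid_basis (matroid_dual E indep) B" for B
    using that unfolding dual_basis_iff by blast
  have ne: "\<exists>B. matroid_basis (matroid_dual E indep) B"
    using basis_extends[OF indep_empty] unfolding dual_basis_iff by blast
  have key: "(\<exists>C. matroid_circuit E indep C \<and> C \<subseteq> K) \<longleftrightarrow>
      (\<forall>B. matroid_basis (matroid_dual E indep) B \<longrightarrow> K \<inter> B \<noteq> {})" if K: "K \<subseteq> E" for K
  proof -
    have "(\<exists>C. matroid_circuit E indep C \<and> C \<subseteq> K) \<longleftrightarrow> \<not> indep K"
    proof
      assume "\<exists>C. matroid_circuit E indep C \<and> C \<subseteq> K"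
      then obtain C where C: "\<not> indep C" "C \<subseteq> K" unfolding matroid_circuit_def by blast
      show "\<not> indep K"
      proof
        assume "indep K"
        then have "indep C" using C(2) by (rule indep_mono)
        with C(1) show False by contradiction
      qed
    next
      assume "\<not> indep K"
      with K show "\<exists>C. matroid_circuit E indep C \<and> C \<subseteq> K" by (rule dependent_contains_circuit)
    qed
    moreover have "indep K \<longleftrightarrow> (\<exists>B. matroid_basis indep B \<and> K \<subseteq> B)"
    proof
      assume "indep K"
      then show "\<exists>B. matroid_basis indep B \<and> K \<subseteq> B" by (rule basis_extends)
    next
      assume "\<exists>B. matroid_basis indep B \<and> K \<subseteq> B"
      then obtain B where "indep B" "K \<subseteq> B" unfolding matroid_basis_def by blast
      then show "indep K" by (rule indep_mono)
    qed
    moreover have "K \<subseteq> B \<longleftrightarrow> K \<inter> (E - B) = {}" for B using K by blast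
    ultimately have "(\<exists>C. matroid_circuit E indep C \<and> C \<subseteq> K) \<longleftrightarrow>
        \<not> (\<exists>B. matroid_basis indep B \<and> K \<inter> (E - B) = {})" by simp
    also have "\<dots> \<longleftrightarrow> (\<forall>B. matroid_basis (matroid_dual E indep) B \<longrightarrow> K \<inter> B \<noteq> {})"
      unfolding dual_basis_iff by blast
    finally show ?thesis .
  qed
  have "(sr_symbolic_power E indep 1 :: ('e, 'l) mpoly set) =
      (\<Inter>B\<in>{B. matroid_basis (matroid_dual E indep) B}.
        {p. \<forall>m\<in>Poly_Mapping.keys p. Poly_Mapping.keys m \<subseteq> E \<and> Poly_Mapping.keys m \<inter> B \<noteq> {}})"
    unfolding sr_symbolic_power_def
  proof (rule INF_cong)
    fix B assume "B \<in> {B. matroid_basis (matroid_dual E indep) B}"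
    then have B: "B \<subseteq> E" using dualE by simp
    show "(Idl\<^bsub>?R\<^esub> (mpoly_var ` B)) [^]\<^bsub>ideals_set ?R\<^esub> (1::nat) =
        {p. \<forall>m\<in>Poly_Mapping.keys p. Poly_Mapping.keys m \<subseteq> E \<and> Poly_Mapping.keys m \<inter> B \<noteq> {}}"
      using pow1[OF B] lin[OF B] by (rule trans)
  qed simp
  also have "\<dots> = {p. \<forall>m\<in>Poly_Mapping.keys p. Poly_Mapping.keys m \<subseteq> E \<and>
        (\<exists>C. matroid_circuit E indep C \<and> C \<subseteq> Poly_Mapping.keys m)}"
    (is "?P = ?Q")
  proof -
    have "?P = {p. \<forall>m\<in>Poly_Mapping.keys p. Poly_Mapping.keys m \<subseteq> E \<and>
        (\<forall>B. matroid_basis (matroid_dual E indep) B \<longrightarrow> Poly_Mapping.keys m \<inter> B \<noteq> {})}"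
      using ne by blast
    also have "\<dots> = ?Q" by (simp add: key cong: conj_cong)
    finally show ?thesis .
  qed
  finally show ?thesis using SR by simp
qed

end

theory Submission
  imports Defs
begin

text \<open>Let \<open>N\<close> have rank \<open>\<rho>\<close> and put \<open>m = n - \<rho>\<close>. A monomial \<open>x\<^sup>a\<close> lies in the \<open>s\<close>-th symbolic power iff
  every basis \<open>B\<close> satisfies \<open>a(E - B) \<ge> s\<close>; evaluating at a basis that is greedy for the level sets
  \<open>U\<^sub>j = {e. a e > j}\<close>, this says that the nullities of the \<open>U\<^sub>j\<close> add up to at least \<open>s\<close>, while the
  degree is the sum of the \<open>card U\<^sub>j\<close>. Hence the least degree is \<open>D(s)\<close>, where
  \<open>D(qm + r) = qn + d\<^sub>r\<close>, as soon as \<open>D\<close> is subadditive on all of \<open>\<nat>\<close>. Inside one period this is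
  subadditivity of \<open>d\<close>, across a period it is \<open>d\<^sub>i + d\<^sub>j \<ge> n + d\<^bsub>i+j-m\<^esub>\<close>.

  In a perfect matroid design with flats of size \<open>f\<^sub>i\<close>, submodularity applied to two flats spanned by
  parts of one basis gives \<open>f\<^sub>a + f\<^sub>b \<le> f\<^bsub>a+b-c\<^esub> + f\<^sub>c\<close>. Both inequalities follow, for \<open>M\<^sup>*\<close> because
  \<open>d\<^sub>i(M\<^sup>*) = n - f\<^bsub>k-i\<^esub>\<close>, and for \<open>M\<close> because \<open>d\<^sub>j(M) = j + a \<le> f\<^sub>a\<close> for the rank \<open>a\<close> of an optimal set.\<close>

section \<open>Rank, nullity and duality\<close>

context matroid
begin

abbreviation rk :: "'e set \<Rightarrow> nat" where
  "rk \<equiv> matroid_rank indep"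

abbreviation nullity :: "'e set \<Rightarrow> nat" where
  "nullity X \<equiv> card X - rk X"

abbreviation ghw :: "nat \<Rightarrow> nat" where
  "ghw \<equiv> gen_hamming_weight E indep"

lemma finite_indep_cards: "finite {card Y | Y. Y \<subseteq> X \<and> indep Y}"
  by (rule finite_subset[of _ "card ` Pow E"]) (auto dest: indep_subset_ground simp: finite_ground)

lemma card_le_rank: "Y \<subseteq> X \<Longrightarrow> indep Y \<Longrightarrow> card Y \<le> rk X"
  unfolding matroid_rank_def by (rule Max_ge[OF finite_indep_cards]) blast

lemma rank_attained: "\<exists>Y. Y \<subseteq> X \<and> indep Y \<and> card Y = rk X"
proof -
  have "{card Y | Y. Y \<subseteq> X \<and> indep Y} \<noteq> {}" using indep_empty by blast
  from Max_in[OF finite_indep_cards this] show ?thesis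
    unfolding matroid_rank_def by (simp only: mem_Collect_eq) metis
qed

text \<open>A maximal independent set between \<open>I\<close> and \<open>X\<close> already has full
  size: a smaller one could be augmented from a rank-attaining set.\<close>

lemma extend_to_rank:
  assumes "I \<subseteq> X" "indep I"
  shows "\<exists>J. I \<subseteq> J \<and> J \<subseteq> X \<and> indep J \<and> card J = rk X"
proof -
  obtain K where K: "K \<subseteq> X" "indep K" "card K = rk X" using rank_attained by blast
  let ?S = "{J. I \<subseteq> J \<and> J \<subseteq> X \<and> indep J}"
  have "finite ?S"
    by (rule finite_subset[of _ "Pow E"]) (auto dest: indep_subset_ground simp: finite_ground)
  moreover have "I \<in> ?S" using assms by blast
  ultimately obtain J where J: "J \<in> ?S" "\<forall>J'\<in>?S. J \<subseteq> J' \<longrightarrow> J = J'"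
    using finite_has_maximal[of ?S] by blast
  have "\<not> card J < card K"
  proof
    assume "card J < card K"
    with augment J K obtain e where "e \<in> K - J" "indep (insert e J)" by blast
    then have "insert e J \<in> ?S" using J K by blast
    with J(2) \<open>e \<in> K - J\<close> show False by blast
  qed
  then have "card J = rk X" using J(1) K card_le_rank[of J X] by simp
  then show ?thesis using J(1) by blast
qed

lemma rank_mono: "X \<subseteq> Y \<Longrightarrow> rk X \<le> rk Y"
  using rank_attained[of X] card_le_rank[of _ Y] by (metis subset_trans)

lemma rank_le_card: "X \<subseteq> E \<Longrightarrow> rk X \<le> card X"
  using rank_attained[of X] by (metis card_mono finite_ground finite_subset)

lemma rank_indep: "indep X \<Longrightarrow> rk X = card X"
  using card_le_rank[of X X] rank_le_card[OF indep_subset_ground] by (simp add: order_antisym)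

lemma rank_empty [simp]: "rk {} = 0"
  using rank_le_card[of "{}"] by simp

lemma rank_submodular:
  assumes "X \<subseteq> E" "Y \<subseteq> E"
  shows "rk (X \<union> Y) + rk (X \<inter> Y) \<le> rk X + rk Y"
proof -
  obtain I where I: "I \<subseteq> X \<inter> Y" "indep I" "card I = rk (X \<inter> Y)"
    using rank_attained by blast
  then obtain J where J: "I \<subseteq> J" "J \<subseteq> X \<union> Y" "indep J" "card J = rk (X \<union> Y)"
    using extend_to_rank[of I "X \<union> Y"] by blast
  have fin: "finite J" using J finite_indep by blast
  have "card J + card I \<le> card ((J \<inter> X) \<union> (J \<inter> Y)) + card ((J \<inter> X) \<inter> (J \<inter> Y))"
  proof (intro add_mono card_mono)
    show "I \<subseteq> (J \<inter> X) \<inter> (J \<inter> Y)" using I J by blast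
  qed (use fin J in auto)
  also have "\<dots> = card (J \<inter> X) + card (J \<inter> Y)"
    by (rule card_Un_Int[symmetric]) (use fin in auto)
  also have "\<dots> \<le> rk X + rk Y"
    using indep_mono[OF J(3), of "J \<inter> X"] indep_mono[OF J(3), of "J \<inter> Y"]
    by (intro add_mono card_le_rank) auto
  finally show ?thesis using I J by simp
qed

lemma rank_insert_le:
  assumes "X \<subseteq> E" "e \<in> E" shows "rk (insert e X) \<le> Suc (rk X)"
  using rank_submodular[of X "{e}"] rank_le_card[of "{e}"] assms by simp

lemma basis_iff: "matroid_basis indep B \<longleftrightarrow> indep B \<and> card B = rk E"
proof
  assume B: "matroid_basis indep B"
  then have "indep B" by (simp add: matroid_basis_def)
  then obtain J where "B \<subseteq> J" "indep J" "card J = rk E"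
    using extend_to_rank[of B E] indep_subset_ground by blast
  then show "indep B \<and> card B = rk E"
    using B unfolding matroid_basis_def by auto
next
  assume B: "indep B \<and> card B = rk E"
  have "X = B" if "indep X" "B \<subseteq> X" for X
    using that B card_le_rank[of X E] indep_subset_ground[of X] card_seteq[of X B] finite_indep[of X]
    by simp
  then show "matroid_basis indep B" using B unfolding matroid_basis_def by blast
qed

lemma nullity_mono:
  assumes "X \<subseteq> Y" "Y \<subseteq> E" shows "nullity X \<le> nullity Y"
proof -
  have fin: "finite Y" using assms finite_ground finite_subset by blast
  have "rk Y \<le> rk X + rk (Y - X)"
    using rank_submodular[of X "Y - X"] assms by (auto simp: Un_absorb1)
  also have "rk (Y - X) \<le> card (Y - X)" by (rule rank_le_card) (use assms in blast)
  also have "card (Y - X) = card Y - card X"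
    using assms fin by (simp add: card_Diff_subset finite_subset)
  finally show ?thesis using card_mono[OF fin assms(1)] by linarith
qed

text \<open>Removing one element lowers the nullity by at most one, so no value between
  \<open>0\<close> and \<open>nullity U\<close> is skipped.\<close>

lemma exists_nullity_subset:
  assumes "U \<subseteq> E" "j \<le> nullity U"
  shows "\<exists>V\<subseteq>U. nullity V = j"
proof -
  have "finite U" using assms finite_ground finite_subset by blast
  then show ?thesis using assms
  proof (induction U rule: finite_induct)
    case empty
    then show ?case by auto
  next
    case (insert e U)
    show ?case
    proof (cases "j \<le> nullity U")
      case True
      with insert show ?thesis by blast
    next
      case False
      have "nullity (insert e U) \<le> Suc (nullity U)"
        using insert rank_mono[OF subset_insertI, of U e] rank_le_card[of U] by simp
      with False insert have "nullity (insert e U) = j" by linarith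
      then show ?thesis by blast
    qed
  qed
qed

section \<open>Generalized Hamming weights\<close>

lemma finite_ghw_set: "finite {card U | U. U \<subseteq> E \<and> card U - rk U = r}"
  by (rule finite_subset[of _ "card ` Pow E"]) (use finite_ground in auto)

text \<open>The definition minimises over sets of nullity exactly \<open>j\<close>; passing to a
  subset lets any set of nullity at least \<open>j\<close> serve as an upper bound.\<close>

lemma ghw_le_card:
  assumes "U \<subseteq> E" "j \<le> nullity U" shows "ghw j \<le> card U"
proof -
  obtain V where V: "V \<subseteq> U" "nullity V = j" using exists_nullity_subset assms by blast
  then have "ghw j \<le> card V"
    unfolding gen_hamming_weight_def using assms by (intro Min_le finite_ghw_set) auto
  also have "\<dots> \<le> card U" using V assms finite_ground by (meson card_mono finite_subset)
  finally show ?thesis .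
qed

lemma ghw_attained:
  assumes "j \<le> card E - rk E"
  shows "\<exists>U\<subseteq>E. card U = ghw j \<and> nullity U = j"
proof -
  have "{card U | U. U \<subseteq> E \<and> card U - rk U = j} \<noteq> {}"
    using exists_nullity_subset[of E j] assms by blast
  from Min_in[OF finite_ghw_set this] show ?thesis
    unfolding gen_hamming_weight_def by (simp only: mem_Collect_eq) metis
qed

lemma ghw_0 [simp]: "ghw 0 = 0"
  using ghw_le_card[of "{}" 0] by simp

lemma ghw_strict_mono:
  assumes "i < j" "j \<le> card E - rk E" shows "ghw i < ghw j"
proof -
  obtain U where U: "U \<subseteq> E" "card U = ghw j" "nullity U = j" using ghw_attained assms by blast
  then obtain V where V: "V \<subseteq> U" "nullity V = i"
    using exists_nullity_subset[of U i] assms by auto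
  then have "V \<subset> U" using U assms by auto
  then have "card V < card U" using U finite_ground by (meson finite_subset psubset_card_mono)
  moreover have "ghw i \<le> card V" using ghw_le_card[of V i] U V by auto
  ultimately show ?thesis using U by simp
qed

lemma ghw_le_ground: "j \<le> card E - rk E \<Longrightarrow> ghw j \<le> card E"
  by (rule ghw_le_card) auto

text \<open>If an optimal set of full nullity missed \<open>e\<close>, then deleting
  \<open>e\<close> from \<open>E\<close> would keep the nullity, hence lower the rank, and
  \<open>e\<close> would lie in every basis.\<close>

lemma ghw_top_no_coloops:
  assumes "\<not> (\<exists>e. matroid_coloop E indep e)"
  shows "ghw (card E - rk E) = card E"
proof -
  obtain U where U: "U \<subseteq> E" "card U = ghw (card E - rk E)" "nullity U = card E - rk E"
    using ghw_attained by blast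
  have "U = E"
  proof (rule ccontr)
    assume "U \<noteq> E"
    then obtain e where e: "e \<in> E" "e \<notin> U" using U by blast
    then have "nullity E \<le> nullity (E - {e})" using U nullity_mono[of U "E - {e}"] by auto
    moreover have "card (E - {e}) < card E" using e finite_ground by (meson card_Diff1_less)
    ultimately have "rk (E - {e}) < rk E" using rank_le_card[OF order_refl]
        rank_le_card[OF Diff_subset, of "{e}"] by linarith
    then have "e \<in> B" if "matroid_basis indep B" for B
      using that card_le_rank[of B "E - {e}"] indep_subset_ground[of B] by (auto simp: basis_iff)
    then show False using e assms by (auto simp: matroid_coloop_def)
  qed
  then show ?thesis using U by simp
qed

text \<open>Extending along the chain never spoils earlier members: there the intersection is
  already as large as the rank permits.\<close>

lemma chain_basis:
  fixes V :: "nat \<Rightarrow> 'e set"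
  assumes "\<And>i j. i \<le> j \<Longrightarrow> V i \<subseteq> V j"
  shows "\<exists>I. I \<subseteq> V t \<and> indep I \<and> (\<forall>i\<le>t. card (I \<inter> V i) = rk (V i))"
proof (induction t)
  case 0
  obtain I where "I \<subseteq> V 0" "indep I" "card I = rk (V 0)" using rank_attained by blast
  then show ?case by (intro exI[of _ I]) (simp add: Int_absorb2)
next
  case (Suc t)
  then obtain I where I: "I \<subseteq> V t" "indep I" "\<And>i. i \<le> t \<Longrightarrow> card (I \<inter> V i) = rk (V i)" by blast
  with assms[of t "Suc t"] obtain J where J: "I \<subseteq> J" "J \<subseteq> V (Suc t)" "indep J" "card J = rk (V (Suc t))"
    using extend_to_rank[of I "V (Suc t)"] by auto
  have "card (J \<inter> V i) = rk (V i)" if "i \<le> Suc t" for i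
  proof (cases "i = Suc t")
    case True
    then show ?thesis using J by (simp add: Int_absorb2)
  next
    case False
    with I that have "rk (V i) = card (I \<inter> V i)" by simp
    also have "\<dots> \<le> card (J \<inter> V i)" using J finite_indep[of J] by (intro card_mono) auto
    finally show ?thesis
      using card_le_rank[of "J \<inter> V i" "V i"] indep_mono[OF J(3), of "J \<inter> V i"] by auto
  qed
  with J show ?case by blast
qed

text \<open>The greedy algorithm: the level sets form a chain when read from the highest level \<open>T\<close> down to
  \<open>0\<close>, and appending \<open>E\<close> to the chain makes the resulting independent set a basis.\<close>

lemma basis_level_sets:
  fixes a :: "'e \<Rightarrow> nat"
  shows "\<exists>B. matroid_basis indep B \<and>
    (\<forall>j. card ({e\<in>E. j < a e} - B) = nullity {e\<in>E. j < a e})"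
proof -
  \<comment> \<open>A bound for all values of \<open>a\<close> on \<open>E\<close> that makes sense
    for empty \<open>E\<close> too; the level sets are empty from \<open>T\<close> on.\<close>
  define T where "T = (\<Sum>e\<in>E. a e)"
  let ?U = "\<lambda>j. {e\<in>E. j < a e}"
  let ?V = "\<lambda>i. if i \<le> T then ?U (T - i) else E"
  have "?V i \<subseteq> ?V j" if "i \<le> j" for i j using that by auto
  from chain_basis[of ?V "Suc T", OF this]
  obtain I where I: "indep I" "\<forall>i\<le>Suc T. card (I \<inter> ?V i) = rk (?V i)" by auto
  have IE: "I \<subseteq> E" using I indep_subset_ground by blast
  have "card I = rk E" using I(2)[rule_format, of "Suc T"] IE by (simp add: Int_absorb2)
  moreover have "card (?U j - I) = nullity (?U j)" for j
  proof -
    have "card (I \<inter> ?U j) = rk (?U j)"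
    proof (cases "j \<le> T")
      case True
      then show ?thesis using I(2)[rule_format, of "T - j"] by simp
    next
      case False
      have "a e \<le> T" if "e \<in> E" for e
        unfolding T_def using that finite_ground by (intro member_le_sum) auto
      with False have "?U j = {}" by fastforce
      then show ?thesis by (simp only: rank_empty Int_empty_right card.empty)
    qed
    then show ?thesis
      using card_Diff_subset_Int[of "?U j" I] finite_indep[OF I(1)] by (simp add: Int_commute)
  qed
  ultimately show ?thesis using I basis_iff by blast
qed

section \<open>The dual matroid\<close>

lemma matroid_dual: "matroid E (matroid_dual E indep)"
proof
  show "matroid_dual E indep {}"
    using basis_extends[OF indep_empty] by (auto simp: matroid_dual_def)
  fix X Y
  assume X: "matroid_dual E indep X" and Y: "matroid_dual E indep Y" and XY: "card X < card Y"
  obtain B where B: "matroid_basis indep B" "X \<inter> B = {}" "X \<subseteq> E"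
    using X by (auto simp: matroid_dual_def)
  obtain B' where B': "matroid_basis indep B'" "Y \<inter> B' = {}" "Y \<subseteq> E"
    using Y by (auto simp: matroid_dual_def)
  have "B \<subseteq> E - X" "indep B" "B' \<subseteq> E" "indep B'"
    using B B' indep_subset_ground[of B] indep_subset_ground[of B'] by (auto simp: basis_iff)
  have "rk (E - X) = rk E"
    using card_le_rank[OF \<open>B \<subseteq> E - X\<close> \<open>indep B\<close>] B rank_mono[of "E - X" E] by (auto simp: basis_iff)
  moreover have "indep (B' - X)" "B' - X \<subseteq> E - X"
    using \<open>indep B'\<close> \<open>B' \<subseteq> E\<close> indep_mono[of B' "B' - X"] by auto
  \<comment> \<open>\<open>J\<close> is a basis that avoids \<open>X\<close> and contains all of
    \<open>B' - X\<close>. An element of \<open>Y - X\<close> outside \<open>J\<close> can join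
    \<open>X\<close>; if there is none, \<open>J\<close> gets more than \<open>rk E\<close>
    elements.\<close>
  ultimately obtain J where J: "B' - X \<subseteq> J" "J \<subseteq> E - X" "indep J" "card J = rk E"
    using extend_to_rank[of "B' - X" "E - X"] by auto
  have fin: "finite X" "finite Y" "finite J" "finite B'"
    using B B' J \<open>B' \<subseteq> E\<close> finite_ground finite_subset by blast+
  show "\<exists>e\<in>Y - X. matroid_dual E indep (insert e X)"
  proof (rule ccontr)
    assume no: "\<not> ?thesis"
    have "Y - X \<subseteq> J"
    proof
      fix e assume e: "e \<in> Y - X"
      show "e \<in> J"
      proof (rule ccontr)
        assume "e \<notin> J"
        then have "matroid_dual E indep (insert e X)"
          using J e B(3) B'(3) unfolding matroid_dual_def by (auto simp: basis_iff)
        with no e show False by blast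
      qed
    qed
    then have "(B' - X) \<union> (Y - X) \<subseteq> J" using J by blast
    then have "card ((B' - X) \<union> (Y - X)) \<le> card J" using fin by (intro card_mono)
    moreover have "card ((B' - X) \<union> (Y - X)) = card (B' - X) + card (Y - X)"
      using B' fin by (intro card_Un_disjoint) auto
    moreover have "card (B' - X) + card (B' \<inter> X) = card B'"
      using fin by (metis card_Int_Diff add.commute)
    moreover have "card (B' \<inter> X) \<le> card (X - Y)"
      using B' fin by (intro card_mono) auto
    moreover have "card (Y - X) + card (X \<inter> Y) = card Y" "card (X - Y) + card (X \<inter> Y) = card X"
      using fin by (metis card_Int_Diff add.commute Int_commute)+
    ultimately show False using XY J B' by (auto simp: basis_iff)
  qed
qed (auto simp: matroid_dual_def finite_ground)

text \<open>The dual rank formula, arranged without subtraction. One inequality counts a basis that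
  misses a largest dual independent subset of \<open>X\<close>; the other uses \<open>X - J\<close>
  for a basis \<open>J\<close> grown from a rank-attaining part of \<open>E - X\<close>.\<close>

lemma dual_rank:
  assumes "X \<subseteq> E"
  shows "matroid_rank (matroid_dual E indep) X + rk E = card X + rk (E - X)"
proof (rule antisym)
  interpret D: matroid E "matroid_dual E indep" by (rule matroid_dual)
  have fin: "finite X" using assms finite_ground finite_subset by blast
  have split: "card B = card (B \<inter> X) + card (B - X)" if "finite B" for B :: "'e set"
    using that by (rule card_Int_Diff)
  obtain Y where Y: "Y \<subseteq> X" "matroid_dual E indep Y" "card Y = D.rk X"
    using D.rank_attained by blast
  then obtain B where B: "matroid_basis indep B" "Y \<inter> B = {}" by (auto simp: matroid_dual_def)
  then have B1: "indep B" "card B = rk E" "B \<subseteq> E" using indep_subset_ground[of B] by (auto simp: basis_iff)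
  have "card (B - X) \<le> rk (E - X)"
    by (rule card_le_rank) (use B1 indep_mono[of B "B - X"] in auto)
  moreover have "Y \<inter> (B \<inter> X) = {}" using B by blast
  then have "card Y + card (B \<inter> X) \<le> card X"
    using card_Un_disjoint[of Y "B \<inter> X"] card_mono[of X "Y \<union> (B \<inter> X)"] Y B fin
    by (auto simp: finite_subset)
  ultimately show "D.rk X + rk E \<le> card X + rk (E - X)"
    using split[of B] B1 Y finite_indep[of B] by simp
  obtain I where I: "I \<subseteq> E - X" "indep I" "card I = rk (E - X)" using rank_attained by blast
  then obtain J where J: "I \<subseteq> J" "J \<subseteq> E" "indep J" "card J = rk E" using extend_to_rank[of I E] by blast
  then have "finite J" using finite_indep by blast
  have "card (X - J) \<le> D.rk X"
    by (rule D.card_le_rank) (use J assms in \<open>auto simp: matroid_dual_def basis_iff\<close>)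
  moreover have "card I \<le> card (J - X)" using \<open>finite J\<close> I J by (intro card_mono) auto
  moreover have "card X = card (X \<inter> J) + card (X - J)" using fin by (rule card_Int_Diff)
  ultimately show "card X + rk (E - X) \<le> D.rk X + rk E"
    using split[of J] \<open>finite J\<close> I J by (simp add: Int_commute)
qed

text \<open>Minimising the size of \<open>X\<close> at a given dual nullity thus means maximising
  its complement at a given rank, which is how flats enter.\<close>

lemma dual_nullity:
  assumes "X \<subseteq> E"
  shows "card X - matroid_rank (matroid_dual E indep) X = rk E - rk (E - X)"
  using dual_rank[OF assms] rank_mono[of "E - X" E] matroid.rank_le_card[OF matroid_dual assms]
  by auto

end

section \<open>Degrees of symbolic powers\<close>

lemma variable_ideal_power:
  fixes E :: "'e set"
  assumes "B \<subseteq> E" "finite E"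
  shows "(Idl\<^bsub>mpoly_ring E\<^esub> (mpoly_var ` B)) [^]\<^bsub>ideals_set (mpoly_ring E)\<^esub> (s::nat) =
    {p :: ('e, 'l::field) mpoly. \<forall>m\<in>Poly_Mapping.keys p. Poly_Mapping.keys m \<subseteq> E \<and>
      s \<le> (\<Sum>e\<in>B. Poly_Mapping.lookup m e)}" (is "?P [^]\<^bsub>_\<^esub> s = ?J s")
proof -
  let ?R = "mpoly_ring E :: ('e, 'l) mpoly ring"
  let ?W = "\<lambda>s::nat. {m. Poly_Mapping.keys m \<subseteq> E \<and> s \<le> (\<Sum>e\<in>B. Poly_Mapping.lookup m e)}"
  interpret R: cring ?R by (rule mpoly_ring_cring)
  have finB: "finite B" using assms finite_subset by blast
  \<comment> \<open>\<open>?W s\<close> is closed under multiplication by monomials in the variables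
    of \<open>E\<close>, so the ideal it generates has no monomials beyond
    \<open>?W s\<close>.\<close>
  have J_Idl: "Idl\<^bsub>?R\<^esub> ((\<lambda>g. Poly_Mapping.single g (1::'l)) ` ?W s) = ?J s" for s
  proof -
    have "Poly_Mapping.keys m \<subseteq> E \<and> (\<exists>g\<in>?W s. \<exists>h. m = g + h) \<longleftrightarrow> m \<in> ?W s" for m
    proof
      assume "Poly_Mapping.keys m \<subseteq> E \<and> (\<exists>g\<in>?W s. \<exists>h. m = g + h)"
      then obtain g h where "Poly_Mapping.keys m \<subseteq> E" "s \<le> (\<Sum>e\<in>B. Poly_Mapping.lookup g e)" "m = g + h"
        by blast
      then show "m \<in> ?W s" by (simp add: lookup_add sum.distrib)
    next
      assume "m \<in> ?W s"
      moreover have "m = m + 0" by simp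
      ultimately show "Poly_Mapping.keys m \<subseteq> E \<and> (\<exists>g\<in>?W s. \<exists>h. m = g + h)" by blast
    qed
    then show ?thesis by (subst monomial_ideal_eq) auto
  qed
  have vars: "mpoly_var ` B \<subseteq> carrier ?R"
    using assms by (auto simp: mpoly_ring_def mpoly_var_def)
  have P_Idl: "ideal ?P ?R" by (rule R.genideal_ideal[OF vars])
  have var_in: "mpoly_var b \<in> ?P" if "b \<in> B" for b
    using R.genideal_self[OF vars] that by blast
  have J_ideal: "ideal (?J s) ?R" for s
    unfolding J_Idl[symmetric] by (rule R.genideal_ideal) (auto simp: mpoly_ring_def)
  have P_sub: "?P \<subseteq> ?J 1"
  proof (rule R.genideal_minimal[OF J_ideal])
    show "mpoly_var ` B \<subseteq> ?J 1"
    proof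
      fix p :: "('e, 'l) mpoly" assume "p \<in> mpoly_var ` B"
      then obtain b where b: "b \<in> B" "p = mpoly_var b" by blast
      have "(\<Sum>e\<in>B. Poly_Mapping.lookup (Poly_Mapping.single b (1::nat)) e) = 1"
        using b finB by (simp add: lookup_single when_def)
      then show "p \<in> ?J 1" using b assms by (auto simp: mpoly_var_def)
    qed
  qed
  show ?thesis
  proof (induction s)
    case 0
    show ?case by (simp add: nat_pow_def ideals_set_def mpoly_ring_def)
  next
    case (Suc s)
    have "ideal_prod ?R (?J s) ?P = ?J (Suc s)"
    proof
      show "ideal_prod ?R (?J s) ?P \<subseteq> ?J (Suc s)"
      proof
        fix p assume "p \<in> ideal_prod ?R (?J s) ?P"
        then show "p \<in> ?J (Suc s)"
        proof (induction p rule: ideal_prod.induct)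
          case (prod i j)
          have "m \<in> ?W (Suc s)" if "m \<in> Poly_Mapping.keys (i * j)" for m
          proof -
            obtain u v where uv: "m = u + v" "u \<in> Poly_Mapping.keys i" "v \<in> Poly_Mapping.keys j"
              using \<open>m \<in> Poly_Mapping.keys (i * j)\<close> keys_mult[of i j] by blast
            then have "u \<in> ?W s" "v \<in> ?W 1" using prod P_sub by auto
            then show ?thesis
              using uv Poly_Mapping.keys_add[of u v] by (auto simp: lookup_add sum.distrib)
          qed
          then show ?case by (simp add: mpoly_ring_def)
        next
          case (sum p1 p2)
          from this(3,4) show ?case by (rule additive_subgroup.a_closed[OF ideal.axioms(1)[OF J_ideal]])
        qed
      qed
      show "?J (Suc s) \<subseteq> ideal_prod ?R (?J s) ?P"
        unfolding J_Idl[of "Suc s", symmetric]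
      proof (rule R.genideal_minimal[OF R.ideal_prod_is_ideal[OF J_ideal P_Idl]], rule image_subsetI)
        fix m assume m: "m \<in> ?W (Suc s)"
        then have "(\<Sum>e\<in>B. Poly_Mapping.lookup m e) \<noteq> 0" by simp
        then obtain b where b: "b \<in> B" "Poly_Mapping.lookup m b \<noteq> 0"
          by (meson sum.neutral)
        \<comment> \<open>Subtraction of exponents truncates, which is harmless because
          \<open>b\<close> occurs in \<open>m\<close>.\<close>
        define u where "u = m - Poly_Mapping.single b 1"
        have mu: "m = u + Poly_Mapping.single b 1"
          by (rule poly_mapping_eqI)
            (use b in \<open>auto simp: u_def lookup_add minus_poly_mapping.rep_eq lookup_single when_def\<close>)
        have "(\<Sum>e\<in>B. Poly_Mapping.lookup m e) = Suc (\<Sum>e\<in>B. Poly_Mapping.lookup u e)"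
          using b finB by (simp add: mu lookup_add sum.distrib lookup_single when_def)
        moreover have "Poly_Mapping.keys u \<subseteq> Poly_Mapping.keys m"
          by (auto simp: mu in_keys_iff lookup_add)
        ultimately have "Poly_Mapping.single u (1::'l) \<in> ?J s" using m by auto
        then have "Poly_Mapping.single u 1 \<otimes>\<^bsub>?R\<^esub> mpoly_var b \<in> ideal_prod ?R (?J s) ?P"
          using var_in[OF b(1)] by (rule ideal_prod.prod)
        then show "Poly_Mapping.single m 1 \<in> ideal_prod ?R (?J s) ?P"
          by (simp add: mu mpoly_ring_def mpoly_var_def mult_single)
      qed
    qed
    with Suc show ?case by (simp add: nat_pow_def ideals_set_def)
  qed
qed

text \<open>Each monomial of a homogeneous element has its degree and lies in the space by itself,
  so only exponent vectors matter.\<close>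

lemma initial_degree_monomial_space:
  "initial_degree {p :: ('e, 'l::field) mpoly. \<forall>m\<in>Poly_Mapping.keys p. m \<in> W} =
    (LEAST d. \<exists>m\<in>W. (\<Sum>e\<in>Poly_Mapping.keys m. Poly_Mapping.lookup m e) = d)"
proof -
  have "(\<exists>p\<in>{p :: ('e, 'l) mpoly. \<forall>m\<in>Poly_Mapping.keys p. m \<in> W}. p \<noteq> 0 \<and> homogeneous d p) \<longleftrightarrow>
      (\<exists>m\<in>W. (\<Sum>e\<in>Poly_Mapping.keys m. Poly_Mapping.lookup m e) = d)" (is "?L \<longleftrightarrow> ?R") for d
  proof
    assume ?L
    then obtain p :: "('e, 'l) mpoly" where p: "\<forall>m\<in>Poly_Mapping.keys p. m \<in> W" "p \<noteq> 0" "homogeneous d p"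
      by blast
    from \<open>p \<noteq> 0\<close> obtain m where "m \<in> Poly_Mapping.keys p" by (metis all_not_in_conv keys_eq_empty)
    with p show ?R by (auto simp: homogeneous_def)
  next
    assume ?R
    then obtain m where m: "m \<in> W" "(\<Sum>e\<in>Poly_Mapping.keys m. Poly_Mapping.lookup m e) = d" by blast
    then have "homogeneous d (Poly_Mapping.single m (1::'l))" by (simp add: homogeneous_def)
    moreover have "Poly_Mapping.single m (1::'l) \<noteq> 0" by (metis lookup_single_eq lookup_zero zero_neq_one)
    ultimately show ?L using m by (intro bexI[of _ "Poly_Mapping.single m 1"]) auto
  qed
  then show ?thesis unfolding initial_degree_def by presburger
qed

section \<open>Symbolic powers as conditions on exponent vectors\<close>

context matroid
begin

lemma sr_symbolic_power_eq:
  "sr_symbolic_power E indep s =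
    {p :: ('e, 'l::field) mpoly. \<forall>m\<in>Poly_Mapping.keys p. m \<in> {m. Poly_Mapping.keys m \<subseteq> E \<and>
      (\<forall>B. matroid_basis indep B \<longrightarrow> s \<le> (\<Sum>e\<in>E - B. Poly_Mapping.lookup m e))}}"
proof -
  have dual: "{B. matroid_basis (matroid_dual E indep) B} = (\<lambda>B. E - B) ` {B. matroid_basis indep B}"
    unfolding dual_basis_iff by blast
  have "sr_symbolic_power E indep s = (\<Inter>B\<in>{B. matroid_basis indep B}.
      {p :: ('e, 'l) mpoly. \<forall>m\<in>Poly_Mapping.keys p. Poly_Mapping.keys m \<subseteq> E \<and>
        s \<le> (\<Sum>e\<in>E - B. Poly_Mapping.lookup m e)})"
    unfolding sr_symbolic_power_def dual image_image
    by (simp only: variable_ideal_power[OF Diff_subset finite_ground])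
  \<comment> \<open>Some basis exists; over an empty family the intersection would also contain
    polynomials with variables outside \<open>E\<close>.\<close>
  then show ?thesis using basis_extends[OF indep_empty] by blast
qed

lemma initial_degree_sr_symbolic_power:
  assumes lower: "\<And>a::'e \<Rightarrow> nat. (\<And>B. matroid_basis indep B \<Longrightarrow> s \<le> (\<Sum>e\<in>E - B. a e)) \<Longrightarrow> D \<le> (\<Sum>e\<in>E. a e)"
    and upper: "\<exists>a::'e \<Rightarrow> nat. (\<forall>B. matroid_basis indep B \<longrightarrow> s \<le> (\<Sum>e\<in>E - B. a e)) \<and> (\<Sum>e\<in>E. a e) = D"
  shows "initial_degree (sr_symbolic_power E indep s :: ('e, 'l::field) mpoly set) = D"
  unfolding sr_symbolic_power_eq initial_degree_monomial_space
proof (rule Least_equality)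
  have deg: "(\<Sum>e\<in>Poly_Mapping.keys m. Poly_Mapping.lookup m e) = (\<Sum>e\<in>E. Poly_Mapping.lookup m e)"
    if "Poly_Mapping.keys m \<subseteq> E" for m :: "'e \<Rightarrow>\<^sub>0 nat"
    using that finite_ground by (intro sum.mono_neutral_left) (auto simp: in_keys_iff)
  let ?W = "{m. Poly_Mapping.keys m \<subseteq> E \<and>
      (\<forall>B. matroid_basis indep B \<longrightarrow> s \<le> (\<Sum>e\<in>E - B. Poly_Mapping.lookup m e))}"
  obtain a :: "'e \<Rightarrow> nat" where a: "\<And>B. matroid_basis indep B \<Longrightarrow> s \<le> (\<Sum>e\<in>E - B. a e)" "(\<Sum>e\<in>E. a e) = D"
    using upper by blast
  \<comment> \<open>\<open>a\<close> may be nonzero outside \<open>E\<close>, so it is cut down to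
    \<open>E\<close> before it becomes an exponent vector.\<close>
  define m where "m = (\<Sum>e\<in>E. Poly_Mapping.single e (a e))"
  have lookup: "Poly_Mapping.lookup m e = (if e \<in> E then a e else 0)" for e
    using finite_ground by (simp add: m_def lookup_sum lookup_single when_def)
  then have "Poly_Mapping.keys m \<subseteq> E" by (auto simp: in_keys_iff split: if_splits)
  moreover have "(\<Sum>e\<in>X. Poly_Mapping.lookup m e) = (\<Sum>e\<in>X. a e)" if "X \<subseteq> E" for X
    using that by (intro sum.cong) (auto simp: lookup)
  ultimately show "\<exists>m\<in>?W. (\<Sum>e\<in>Poly_Mapping.keys m. Poly_Mapping.lookup m e) = D"
    using a deg by (intro bexI[of _ m]) auto
  fix d assume "\<exists>m\<in>?W. (\<Sum>e\<in>Poly_Mapping.keys m. Poly_Mapping.lookup m e) = d"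
  then obtain m' where m': "m' \<in> ?W" "(\<Sum>e\<in>Poly_Mapping.keys m'. Poly_Mapping.lookup m' e) = d" by blast
  then have "D \<le> (\<Sum>e\<in>E. Poly_Mapping.lookup m' e)" by (intro lower) blast
  then show "D \<le> d" using m' deg by simp
qed

end

section \<open>Periodic extension of weight sequences\<close>

definition periodic_extension :: "nat \<Rightarrow> nat \<Rightarrow> (nat \<Rightarrow> nat) \<Rightarrow> nat \<Rightarrow> nat" where
  "periodic_extension m n d s = (s div m) * n + d (s mod m)"

text \<open>\<open>sub\<close> and \<open>cosub\<close> are what subadditivity of the periodic
  extension says about two remainders whose sum stays within one period or passes it.\<close>

locale bisubadditive =
  fixes m n :: nat and d :: "nat \<Rightarrow> nat"
  assumes pos: "0 < m"
    and zero: "d 0 = 0"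
    and top: "d m = n"
    and mono: "i \<le> j \<Longrightarrow> j \<le> m \<Longrightarrow> d i \<le> d j"
    and sub: "i + j \<le> m \<Longrightarrow> d (i + j) \<le> d i + d j"
    and cosub: "i \<le> m \<Longrightarrow> j \<le> m \<Longrightarrow> m \<le> i + j \<Longrightarrow> n + d (i + j - m) \<le> d i + d j"
begin

abbreviation D :: "nat \<Rightarrow> nat" where
  "D \<equiv> periodic_extension m n d"

text \<open>Remainder \<open>m\<close> with quotient \<open>q\<close> gives the same value as
  remainder \<open>0\<close> with quotient \<open>q + 1\<close>. Hence remainders may be taken from
  \<open>1..m\<close>, as in the theorem, as well as from \<open>0..m-1\<close>.\<close>

lemma extension_eq: "r \<le> m \<Longrightarrow> D (m * q + r) = q * n + d r"
  using pos top zero by (cases "r = m") (auto simp: periodic_extension_def)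

lemma extension_le: "r \<le> m \<Longrightarrow> D r = d r"
  using extension_eq[of r 0] by simp

lemma extension_subadditive: "D (x + y) \<le> D x + D y"
proof -
  define i j where "i = x mod m" and "j = y mod m"
  have ij: "i < m" "j < m" using pos by (auto simp: i_def j_def)
  have x: "x = m * (x div m) + i" and y: "y = m * (y div m) + j" by (auto simp: i_def j_def)
  have Dx: "D x = (x div m) * n + d i" "D y = (y div m) * n + d j"
    by (auto simp: periodic_extension_def i_def j_def)
  show ?thesis
  proof (cases "i + j \<le> m")
    case True
    have "x + y = m * (x div m + y div m) + (i + j)" using x y by (simp add: algebra_simps)
    then have "D (x + y) = (x div m + y div m) * n + d (i + j)" using extension_eq True by metis
    then show ?thesis using sub[OF True] Dx by (simp add: algebra_simps)
  next
    case False
    then have "x + y = m * (x div m + y div m + 1) + (i + j - m)" using x y by (simp add: algebra_simps)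
    moreover have "i + j - m \<le> m" using ij by simp
    ultimately have "D (x + y) = (x div m + y div m + 1) * n + d (i + j - m)"
      using extension_eq by metis
    then show ?thesis using cosub[of i j] ij False Dx by (simp add: algebra_simps)
  qed
qed

lemma extension_sum: "D (\<Sum>i\<in>A. f i) \<le> (\<Sum>i\<in>A. D (f i))"
proof (induction A rule: infinite_finite_induct)
  case (insert x F)
  then show ?case using extension_subadditive[of "f x" "\<Sum>i\<in>F. f i"] by simp
qed (auto simp: extension_le zero)

lemma extension_mono: assumes "x \<le> y" shows "D x \<le> D y"
proof (cases "x div m = y div m")
  case True
  then have "x mod m \<le> y mod m"
    using assms by (metis add_le_cancel_left mult_div_mod_eq)
  then show ?thesis using True mono[of "x mod m" "y mod m"] pos
    by (simp add: periodic_extension_def less_imp_le)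
next
  case False
  have "d (x mod m) \<le> n" using mono[of "x mod m" m] pos top by (simp add: less_imp_le)
  then have "D x \<le> (x div m + 1) * n" by (simp add: periodic_extension_def)
  also have "\<dots> \<le> (y div m) * n"
    using False div_le_mono[OF assms, of m] by (intro mult_le_mono) auto
  also have "\<dots> \<le> D y" by (simp add: periodic_extension_def)
  finally show ?thesis .
qed

lemma extension_average: "(\<lambda>s. real (D s) / real s) \<longlonglongrightarrow> real n / real m"
proof -
  \<comment> \<open>The deviation from the slope \<open>n / m\<close> comes only from the last
    incomplete period, so \<open>n\<close> bounds it before the division by
    \<open>s\<close>.\<close>
  have bound: "norm (real (D s) / real s - real n / real m) \<le> real n / real s" if "s \<ge> 1" for s
  proof -
    have "d (s mod m) \<le> n" using mono[of "s mod m" m] pos top by (simp add: less_imp_le)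
    then have b1: "real (d (s mod m)) \<le> real n" by simp
    have "real s = real m * real (s div m) + real (s mod m)"
      by (metis mult_div_mod_eq of_nat_add of_nat_mult)
    then have q: "real (s div m) = (real s - real (s mod m)) / real m" using pos by (simp add: field_simps)
    have eq: "real (D s) / real s - real n / real m
        = (real (d (s mod m)) - real (s mod m) / real m * real n) / real s"
      using that pos by (simp add: periodic_extension_def q field_simps)
    have "real (s mod m) / real m \<le> 1" using pos by (simp add: less_imp_le)
    then have "real (s mod m) / real m * real n \<le> 1 * real n" by (intro mult_right_mono) auto
    moreover have "0 \<le> real (s mod m) / real m * real n" by simp
    ultimately have "\<bar>real (d (s mod m)) - real (s mod m) / real m * real n\<bar> \<le> real n"
      using b1 by linarith
    then show ?thesis unfolding eq by (simp add: divide_right_mono)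
  qed
  have "(\<lambda>s. real n / real s) \<longlonglongrightarrow> 0"
    by (rule lim_const_over_n)
  then have "(\<lambda>s. real (D s) / real s - real n / real m) \<longlonglongrightarrow> 0"
  proof (rule tendsto_0_le)
    show "\<forall>\<^sub>F s in sequentially. norm (real (D s) / real s - real n / real m) \<le> norm (real n / real s) * 1"
      using bound by (intro eventually_sequentiallyI[of 1]) simp
  qed
  then show ?thesis by (simp add: LIM_zero_iff)
qed

end

section \<open>Initial degrees of symbolic powers from the weights\<close>

context matroid
begin

lemma initial_degree_symbolic_power:
  assumes bs: "bisubadditive m (card E) ghw" and m: "m = card E - rk E"
  shows "initial_degree (sr_symbolic_power E indep s :: ('e, 'l::field) mpoly set)
    = periodic_extension m (card E) ghw s"
proof -
  interpret bisubadditive m "card E" ghw by (rule bs)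
  show ?thesis
  proof (rule initial_degree_sr_symbolic_power)
    fix a :: "'e \<Rightarrow> nat"
    assume a: "\<And>B. matroid_basis indep B \<Longrightarrow> s \<le> (\<Sum>e\<in>E - B. a e)"
    let ?U = "\<lambda>j. {e\<in>E. j < a e}"
    define T where "T = (\<Sum>e\<in>E. a e)"
    \<comment> \<open>Layer-cake summation: \<open>a e\<close> counts the levels \<open>j\<close>
      below it, and all of these lie below \<open>T\<close>.\<close>
    have level: "(\<Sum>e\<in>X. a e) = (\<Sum>j<T. card (X \<inter> {e. j < a e}))" if "X \<subseteq> E" for X
    proof -
      have fin: "finite X" using that finite_ground finite_subset by blast
      have "a e = (\<Sum>j<T. if j < a e then 1 else 0)" if "e \<in> X" for e
      proof -
        have "a e \<le> T" unfolding T_def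
          using \<open>X \<subseteq> E\<close> that finite_ground by (intro member_le_sum) auto
        then have "{..<T} \<inter> {j. j < a e} = {..<a e}" by auto
        then show ?thesis by (simp add: sum.If_cases)
      qed
      then have "(\<Sum>e\<in>X. a e) = (\<Sum>e\<in>X. \<Sum>j<T. if j < a e then 1 else 0)" by (rule sum.cong[OF refl])
      also have "\<dots> = (\<Sum>j<T. \<Sum>e\<in>X. if j < a e then 1 else 0)" by (rule sum.swap)
      also have "\<dots> = (\<Sum>j<T. card (X \<inter> {e. j < a e}))" using fin by (simp add: sum.If_cases)
      finally show ?thesis .
    qed
    \<comment> \<open>For this basis the constraint on \<open>a\<close> involves only nullities of
      level sets, so subadditivity of \<open>D\<close> applies level by level.\<close>
    obtain B where B: "matroid_basis indep B" "\<And>j. card (?U j - B) = nullity (?U j)"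
      using basis_level_sets[of a] by blast
    have "(E - B) \<inter> {e. j < a e} = ?U j - B" "E \<inter> {e. j < a e} = ?U j" for j by auto
    note eqs = this
    have "s \<le> (\<Sum>e\<in>E - B. a e)" using a B by blast
    also have "\<dots> = (\<Sum>j<T. nullity (?U j))" using level[of "E - B"] B by (simp add: eqs)
    finally have "D s \<le> D (\<Sum>j<T. nullity (?U j))" by (rule extension_mono)
    also have "\<dots> \<le> (\<Sum>j<T. D (nullity (?U j)))" by (rule extension_sum)
    also have "\<dots> \<le> (\<Sum>j<T. card (?U j))"
    proof (rule sum_mono)
      fix j
      have "nullity (?U j) \<le> m" unfolding m by (rule nullity_mono) auto
      then show "D (nullity (?U j)) \<le> card (?U j)"
        using ghw_le_card[of "?U j" "nullity (?U j)"] by (simp add: extension_le)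
    qed
    also have "\<dots> = (\<Sum>e\<in>E. a e)" using level[of E] by (simp add: eqs)
    finally show "D s \<le> (\<Sum>e\<in>E. a e)" .
  next
    define r q where "r = s mod m" and "q = s div m"
    have "r \<le> m" using pos by (simp add: r_def less_imp_le)
    then obtain U where U: "U \<subseteq> E" "card U = ghw r" "nullity U = r" using ghw_attained[of r] m by blast
    \<comment> \<open>Every element gets weight \<open>q\<close>, and those of an optimal set for
      the remainder one more. Outside a basis this adds up to \<open>q * m\<close> plus at least the
      nullity of \<open>U\<close>.\<close>
    define a where "a e = q + (if e \<in> U then 1 else 0)" for e
    have sum_a: "(\<Sum>e\<in>X. a e) = q * card X + card (X \<inter> U)" if "X \<subseteq> E" for X
      using finite_subset[OF that finite_ground] by (simp add: a_def sum.distrib sum.If_cases)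
    show "\<exists>a::'e \<Rightarrow> nat. (\<forall>B. matroid_basis indep B \<longrightarrow> s \<le> (\<Sum>e\<in>E - B. a e)) \<and> (\<Sum>e\<in>E. a e) = D s"
    proof (intro exI[of _ a] conjI allI impI)
      fix B assume "matroid_basis indep B"
      then have B: "indep B" "card B = rk E" by (auto simp: basis_iff)
      have "card (E - B) = m" unfolding m
        using B indep_subset_ground[OF B(1)] finite_indep[OF B(1)] by (simp add: card_Diff_subset)
      moreover have "card (B \<inter> U) \<le> rk U" using indep_mono[OF B(1), of "B \<inter> U"] by (intro card_le_rank) auto
      moreover have "card ((E - B) \<inter> U) + card (B \<inter> U) = card U"
      proof -
        have "finite U" using U finite_ground finite_subset by blast
        then have "card (U - B) + card (U \<inter> B) = card U" by (metis card_Int_Diff add.commute)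
        moreover have "(E - B) \<inter> U = U - B" using U by blast
        ultimately show ?thesis by (simp add: Int_commute)
      qed
      moreover have "s = q * m + r" by (simp add: q_def r_def)
      ultimately show "s \<le> (\<Sum>e\<in>E - B. a e)" using U sum_a[OF Diff_subset, of B] by simp
    next
      show "(\<Sum>e\<in>E. a e) = D s"
        using sum_a[of E] U by (simp add: Int_absorb1 periodic_extension_def r_def q_def)
    qed
  qed
qed

end

section \<open>Flat sizes of a perfect matroid design\<close>

locale loopless_matroid_design = matroid E indep
  for E :: "'e set" and indep :: "'e set \<Rightarrow> bool" +
  assumes design: "perfect_matroid_design E indep"
    and loopless: "\<not> (\<exists>e. matroid_loop E indep e)"
begin

text \<open>Maximising over all sets of a rank, not only flats, yields
  \<open>card_le_flat_size\<close> at once; \<open>card_flat\<close> identifies the value with the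
  common size of flats. For \<open>i\<close> above \<open>rk E\<close> it is an unspecified
  \<open>Max {}\<close>.\<close>

definition flat_size :: "nat \<Rightarrow> nat" where
  "flat_size i = Max {card X | X. X \<subseteq> E \<and> rk X = i}"

lemma finite_rank_cards: "finite {card X | X. X \<subseteq> E \<and> rk X = i}"
  by (rule finite_subset[of _ "card ` Pow E"]) (auto simp: finite_ground)

lemma card_le_flat_size: "X \<subseteq> E \<Longrightarrow> card X \<le> flat_size (rk X)"
  unfolding flat_size_def by (rule Max_ge[OF finite_rank_cards]) blast

lemma flat_size_attained:
  assumes "i \<le> rk E" shows "\<exists>X\<subseteq>E. rk X = i \<and> card X = flat_size i"
proof -
  obtain J where J: "J \<subseteq> E" "indep J" "card J = rk E" using rank_attained by blast
  then obtain I where I: "I \<subseteq> J" "card I = i" using assms by (metis obtain_subset_with_card_n)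
  then have "rk I = i" using rank_indep indep_mono[OF J(2)] by blast
  then have "{card X | X. X \<subseteq> E \<and> rk X = i} \<noteq> {}" using I J by blast
  from Max_in[OF finite_rank_cards this] show ?thesis
    unfolding flat_size_def by (simp only: mem_Collect_eq) metis
qed

lemma rank_0_empty: assumes "X \<subseteq> E" "rk X = 0" shows "X = {}"
proof (rule ccontr)
  assume "X \<noteq> {}"
  then obtain e where e: "e \<in> X" by blast
  then have "indep {e}" using loopless assms by (auto simp: matroid_loop_def)
  then show False using card_le_rank[of "{e}" X] e assms by simp
qed

lemma maximal_imp_flat:
  assumes "X \<subseteq> E" "\<And>Y. X \<subseteq> Y \<Longrightarrow> Y \<subseteq> E \<Longrightarrow> rk Y = rk X \<Longrightarrow> Y = X"
  shows "matroid_flat E indep X"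
  unfolding matroid_flat_def
proof (intro conjI ballI)
  fix e assume e: "e \<in> E - X"
  then have "rk (insert e X) \<noteq> rk X" using assms(2)[of "insert e X"] assms(1) by blast
  then show "rk X < rk (insert e X)" using rank_mono[OF subset_insertI, of X e] by simp
qed (rule assms(1))

lemma extend_to_flat:
  assumes "A \<subseteq> E" shows "\<exists>F. A \<subseteq> F \<and> F \<subseteq> E \<and> matroid_flat E indep F \<and> rk F = rk A"
proof -
  let ?S = "{F. A \<subseteq> F \<and> F \<subseteq> E \<and> rk F = rk A}"
  have "finite ?S" by (rule finite_subset[of _ "Pow E"]) (auto simp: finite_ground)
  have "?S \<noteq> {}" using assms by blast
  obtain F where F: "F \<in> ?S" "\<And>G. G \<in> ?S \<Longrightarrow> F \<subseteq> G \<Longrightarrow> F = G"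
    using finite_has_maximal[OF \<open>finite ?S\<close> \<open>?S \<noteq> {}\<close>] by auto
  have "matroid_flat E indep F"
  proof (rule maximal_imp_flat)
    fix Y assume "F \<subseteq> Y" "Y \<subseteq> E" "rk Y = rk F"
    then show "Y = F" using F(1) F(2)[of Y] by auto
  qed (use F in simp)
  with F show ?thesis by blast
qed

lemma card_flat:
  assumes F: "matroid_flat E indep F" shows "card F = flat_size (rk F)"
proof -
  have FE: "F \<subseteq> E" using F by (simp add: matroid_flat_def)
  obtain X where X: "X \<subseteq> E" "rk X = rk F" "card X = flat_size (rk F)"
    using flat_size_attained rank_mono[OF FE] by blast
  show ?thesis
  \<comment> \<open>The design condition starts at rank \<open>1\<close>; in rank \<open>0\<close>
    the absence of loops leaves only the empty set.\<close>
  proof (cases "rk F = 0")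
    case True
    then show ?thesis using rank_0_empty FE X by metis
  next
    case False
    have "matroid_flat E indep X"
    proof (rule maximal_imp_flat[OF X(1)])
      fix Y assume Y: "X \<subseteq> Y" "Y \<subseteq> E" "rk Y = rk X"
      then have "card Y \<le> card X" using card_le_flat_size[OF Y(2)] X by simp
      then show "Y = X" using Y finite_ground by (metis card_seteq finite_subset)
    qed
    moreover have "rk F \<in> {1..rk E}" using False rank_mono[OF FE] by simp
    ultimately show ?thesis using design F X unfolding perfect_matroid_design_def by metis
  qed
qed

lemma flat_size_0: "flat_size 0 = 0"
  using flat_size_attained[of 0] rank_0_empty by (metis card.empty zero_le)

lemma flat_size_top: "flat_size (rk E) = card E"
proof -
  have "flat_size (rk E) \<le> card E"
    using flat_size_attained[of "rk E"] finite_ground by (metis card_mono order_refl)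
  then show ?thesis using card_le_flat_size[of E] by simp
qed

text \<open>Spread two subsets of a basis to flats; their union and intersection have the ranks that
  submodularity predicts. The design property makes both flats largest of their rank simultaneously.\<close>

lemma flat_size_supermodular:
  assumes c: "c \<le> a" "c \<le> b" and ab: "a + b - c \<le> rk E"
  shows "flat_size a + flat_size b \<le> flat_size (a + b - c) + flat_size c"
proof -
  obtain J where J: "J \<subseteq> E" "indep J" "card J = rk E" using rank_attained by blast
  obtain S where S: "S \<subseteq> J" "card S = a + b - c" using ab J by (metis obtain_subset_with_card_n)
  obtain A where A: "A \<subseteq> S" "card A = a"
    using S c by (metis add_diff_assoc le_add1 obtain_subset_with_card_n)
  obtain C where C: "C \<subseteq> A" "card C = c" using A c by (metis obtain_subset_with_card_n)
  have finS: "finite S" using S J finite_indep finite_subset by blast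
  define B where "B = C \<union> (S - A)"
  have "card (S - A) = b - c"
    using A S finS c by (subst card_Diff_subset) (auto dest: finite_subset)
  then have "card B = b"
    unfolding B_def using C A c finS by (subst card_Un_disjoint) (auto dest: finite_subset)
  have sub: "A \<union> B = S" "A \<inter> B = C" using A C by (auto simp: B_def)
  have ind: "indep X" "rk X = card X" "X \<subseteq> E" if "X \<subseteq> S" for X
    using indep_mono[OF J(2), of X] rank_indep[of X] that S J by auto
  have AB: "A \<subseteq> S" "B \<subseteq> S" using sub by auto
  obtain F where F: "A \<subseteq> F" "F \<subseteq> E" "matroid_flat E indep F" "rk F = a"
    using extend_to_flat[OF ind(3)[OF AB(1)]] ind(2)[OF AB(1)] A by auto
  obtain G where G: "B \<subseteq> G" "G \<subseteq> E" "matroid_flat E indep G" "rk G = b"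
    using extend_to_flat[OF ind(3)[OF AB(2)]] ind(2)[OF AB(2)] \<open>card B = b\<close> by auto
  have "a + b - c \<le> rk (F \<union> G)"
    using rank_mono[of S "F \<union> G"] ind(2)[of S] S F G sub by auto
  moreover have "C \<subseteq> F \<inter> G" "C \<subseteq> S" using F G sub by blast+
  then have "c \<le> rk (F \<inter> G)"
    using rank_mono[of C "F \<inter> G"] ind(2)[of C] C by simp
  \<comment> \<open>Submodularity bounds the sum of the two ranks by \<open>a + b\<close>, which is
    also the sum of the two lower bounds, so both are attained.\<close>
  ultimately have "rk (F \<union> G) = a + b - c" "rk (F \<inter> G) = c"
    using rank_submodular[OF F(2) G(2)] F G c by linarith+
  then have "card (F \<union> G) \<le> flat_size (a + b - c)" "card (F \<inter> G) \<le> flat_size c"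
    using card_le_flat_size[of "F \<union> G"] card_le_flat_size[of "F \<inter> G"] F G by auto
  moreover have "card F + card G = card (F \<union> G) + card (F \<inter> G)"
    using F G finite_ground by (intro card_Un_Int) (auto dest: finite_subset)
  ultimately show ?thesis using card_flat[OF F(3)] card_flat[OF G(3)] F G by simp
qed

text \<open>A largest set of rank \<open>i\<close> misses an element of some basis that extends its
  own; adding this element raises rank and size by one.\<close>

lemma flat_size_Suc: assumes "i < rk E" shows "flat_size i < flat_size (Suc i)"
proof -
  obtain X where X: "X \<subseteq> E" "rk X = i" "card X = flat_size i" using flat_size_attained[of i] assms by auto
  obtain I where I: "I \<subseteq> X" "indep I" "card I = i" using rank_attained[of X] X by blast
  obtain J where J: "I \<subseteq> J" "J \<subseteq> E" "indep J" "card J = rk E"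
    using extend_to_rank[of I E] I X by blast
  have "\<not> J \<subseteq> X" using card_le_rank[of J X] J X assms by auto
  then obtain e where e: "e \<in> J" "e \<notin> X" by blast
  have "indep (insert e I)" using e J indep_mono[OF J(3), of "insert e I"] by blast
  then have "card (insert e I) \<le> rk (insert e X)" using I by (intro card_le_rank) auto
  then have "Suc i \<le> rk (insert e X)" using I e finite_indep[OF I(2)] by (auto simp: card_insert_if split: if_splits)
  then have "rk (insert e X) = Suc i" using rank_insert_le[of X e] X e J by auto
  then have "card (insert e X) \<le> flat_size (Suc i)"
    using card_le_flat_size[of "insert e X"] X e J by auto
  moreover have "card (insert e X) = Suc (card X)"
    using e X finite_ground by (meson card_insert_disjoint finite_subset)
  ultimately show ?thesis using X by simp
qed

lemma flat_size_less: "i < j \<Longrightarrow> j \<le> rk E \<Longrightarrow> flat_size i < flat_size j"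
proof (induction j)
  case (Suc j)
  then show ?case using flat_size_Suc[of j] by (cases "i = j") auto
qed simp

lemma flat_size_mono: "i \<le> j \<Longrightarrow> j \<le> rk E \<Longrightarrow> flat_size i \<le> flat_size j"
  using flat_size_less[of i j] by (cases "i = j") auto

section \<open>Weights of the dual matroid\<close>

lemma dual_ghw:
  assumes "i \<le> rk E"
  shows "gen_hamming_weight E (matroid_dual E indep) i = card E - flat_size (rk E - i)"
proof (rule antisym)
  interpret D: matroid E "matroid_dual E indep" by (rule matroid_dual)
  obtain X where X: "X \<subseteq> E" "rk X = rk E - i" "card X = flat_size (rk E - i)"
    using flat_size_attained[of "rk E - i"] by auto
  have EX: "E - (E - X) = X" using X by blast
  have "D.ghw i \<le> card (E - X)"
    using dual_nullity[of "E - X"] X assms by (intro D.ghw_le_card) (auto simp: EX)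
  then show "D.ghw i \<le> card E - flat_size (rk E - i)"
    using X finite_subset[OF X(1) finite_ground] by (simp add: card_Diff_subset)
  have "D.nullity E = rk E" using dual_nullity[of E] by simp
  then obtain U where U: "U \<subseteq> E" "card U = D.ghw i" "D.nullity U = i"
    using D.ghw_attained[of i] assms by auto
  then have "rk (E - U) = rk E - i"
    using dual_nullity[of U] rank_mono[of "E - U" E] by auto
  then have "card (E - U) \<le> flat_size (rk E - i)"
    using card_le_flat_size[of "E - U"] by auto
  then show "card E - flat_size (rk E - i) \<le> D.ghw i"
    using U finite_subset[OF U(1) finite_ground] by (simp add: card_Diff_subset)
qed

text \<open>Both inequalities are extreme cases of supermodularity: \<open>sub\<close> has the union
  of full rank, \<open>cosub\<close> has the intersection of rank \<open>0\<close>.\<close>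

lemma dual_bisubadditive:
  assumes "0 < rk E"
  shows "bisubadditive (rk E) (card E) (gen_hamming_weight E (matroid_dual E indep))"
proof
  let ?k = "rk E" and ?n = "card E"
  let ?d = "gen_hamming_weight E (matroid_dual E indep)"
  have le: "flat_size i \<le> ?n" if "i \<le> ?k" for i
    using flat_size_mono[OF that] flat_size_top by simp
  show "?d 0 = 0" using dual_ghw[of 0] flat_size_top by simp
  show "?d ?k = ?n" using dual_ghw[of ?k] flat_size_0 by simp
  show "?d i \<le> ?d j" if "i \<le> j" "j \<le> ?k" for i j
    using that flat_size_mono[of "?k - j" "?k - i"] by (simp add: dual_ghw diff_le_mono2)
  show "?d (i + j) \<le> ?d i + ?d j" if "i + j \<le> ?k" for i j
  proof -
    have "?k - i + (?k - j) - (?k - (i + j)) = ?k" using that by simp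
    then have "flat_size (?k - i) + flat_size (?k - j) \<le> ?n + flat_size (?k - (i + j))"
      using flat_size_supermodular[of "?k - (i + j)" "?k - i" "?k - j"] that flat_size_top by simp
    moreover have "flat_size (?k - i) \<le> ?n" "flat_size (?k - j) \<le> ?n" using le by auto
    ultimately have "?n - flat_size (?k - (i + j)) \<le> (?n - flat_size (?k - i)) + (?n - flat_size (?k - j))"
      by linarith
    then show ?thesis using that by (simp add: dual_ghw)
  qed
  show "?n + ?d (i + j - ?k) \<le> ?d i + ?d j" if "i \<le> ?k" "j \<le> ?k" "?k \<le> i + j" for i j
  proof -
    have eq: "?k - (i + j - ?k) = (?k - i) + (?k - j)" using that by simp
    have "flat_size (?k - i) + flat_size (?k - j) \<le> flat_size ((?k - i) + (?k - j))"
      using flat_size_supermodular[of 0 "?k - i" "?k - j"] that flat_size_0 by simp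
    moreover have "flat_size ((?k - i) + (?k - j)) \<le> ?n" using le that by simp
    moreover have "?d (i + j - ?k) = ?n - flat_size ((?k - i) + (?k - j))"
      using that dual_ghw[of "i + j - ?k"] unfolding eq by simp
    ultimately show ?thesis using that by (simp add: dual_ghw)
  qed
qed (rule assms)

section \<open>Weights of the design itself\<close>

lemma large_nullity:
  assumes "c \<le> rk E" "w \<le> flat_size c"
  shows "\<exists>W\<subseteq>E. card W = w \<and> w - c \<le> nullity W"
proof -
  obtain X where X: "X \<subseteq> E" "rk X = c" "card X = flat_size c" using flat_size_attained assms by blast
  then obtain W where "W \<subseteq> X" "card W = w" using assms by (metis obtain_subset_with_card_n)
  then show ?thesis using X rank_mono[of W X] by (intro exI[of _ W]) auto
qed

text \<open>Any \<open>w\<close> elements of a largest set of rank \<open>c\<close> have rank at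
  most \<open>c\<close>, hence nullity at least \<open>j\<close>. Together with
  \<open>ghw_rank\<close> this translates between weights and flat sizes.\<close>

lemma ghw_le_of_flat_size:
  assumes "c \<le> rk E" "w \<le> flat_size c" "j + c \<le> w"
  shows "ghw j \<le> w"
  using large_nullity[OF assms(1,2)] ghw_le_card[of _ j] assms(3) by fastforce

lemma ghw_rank:
  assumes "j \<le> card E - rk E"
  shows "\<exists>a\<le>rk E. ghw j = j + a \<and> ghw j \<le> flat_size a"
proof -
  obtain U where U: "U \<subseteq> E" "card U = ghw j" "nullity U = j" using ghw_attained assms by blast
  then have "ghw j = j + rk U" using rank_le_card[of U] by simp
  then show ?thesis using U rank_mono[of U E] card_le_flat_size[of U] by auto
qed

lemma ghw_subadditive:
  assumes ij: "i + j \<le> card E - rk E" shows "ghw (i + j) \<le> ghw i + ghw j"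
proof -
  obtain a where a: "a \<le> rk E" "ghw i = i + a" "ghw i \<le> flat_size a" using ghw_rank[of i] ij by auto
  obtain b where b: "b \<le> rk E" "ghw j = j + b" "ghw j \<le> flat_size b" using ghw_rank[of j] ij by auto
  \<comment> \<open>In the first case supermodularity merges the two flats. In the last, any set of
    \<open>ghw i + ghw j\<close> elements has nullity above \<open>i + j\<close>, since its rank is
    at most \<open>rk E\<close>.\<close>
  consider "a + b \<le> rk E" | "card E \<le> ghw i + ghw j" | "rk E < a + b" "ghw i + ghw j < card E"
    by linarith
  then show ?thesis
  proof cases
    case 1
    then have "ghw i + ghw j \<le> flat_size (a + b)"
      using flat_size_supermodular[of 0 a b] a b flat_size_0 by simp
    then show ?thesis using 1 a b by (intro ghw_le_of_flat_size[of "a + b"]) auto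
  next
    case 2
    then show ?thesis using ghw_le_ground[OF ij] by simp
  next
    case 3
    then show ?thesis using a b flat_size_top by (intro ghw_le_of_flat_size[of "rk E"]) auto
  qed
qed

lemma ghw_cosubadditive:
  assumes top: "ghw (card E - rk E) = card E"
    and i: "i \<le> card E - rk E" and j: "j \<le> card E - rk E" and ij: "card E - rk E \<le> i + j"
  shows "card E + ghw (i + j - (card E - rk E)) \<le> ghw i + ghw j"
proof -
  let ?k = "rk E" and ?n = "card E"
  have kn: "?k \<le> ?n" by (rule rank_le_card) simp
  obtain a where a: "a \<le> ?k" "ghw i = i + a" "ghw i \<le> flat_size a" using ghw_rank[OF i] by blast
  obtain b where b: "b \<le> ?k" "ghw j = j + b" "ghw j \<le> flat_size b" using ghw_rank[OF j] by blast
  show ?thesis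
  proof (cases "?k \<le> a + b")
    case True
    moreover have "a + b - ?k \<le> a" "a + b - ?k \<le> b" using a b by linarith+
    ultimately have "ghw i + ghw j \<le> ?n + flat_size (a + b - ?k)"
      using flat_size_supermodular[of "a + b - ?k" a b] a b flat_size_top by simp
    moreover have "?n \<le> ghw i + ghw j" using True a b ij by simp
    \<comment> \<open>For \<open>ghw i + ghw j - ?n\<close> elements in rank
      \<open>a + b - ?k\<close> the guaranteed nullity is exactly the index needed.\<close>
    ultimately have "ghw (i + j - (?n - ?k)) \<le> ghw i + ghw j - ?n"
      using True a b ij kn by (intro ghw_le_of_flat_size[of "a + b - ?k"]) auto
    then show ?thesis using \<open>?n \<le> ghw i + ghw j\<close> by simp
  next
    case False
    \<comment> \<open>This case is contradictory: a set of fewer than \<open>?n\<close> elements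
      would have full nullity, against \<open>top\<close>.\<close>
    then have le: "ghw i + ghw j \<le> flat_size (a + b)"
      using flat_size_supermodular[of 0 a b] a b flat_size_0 by simp
    have "ghw (?n - ?k) \<le> ghw i + ghw j"
      using False a b ij le by (intro ghw_le_of_flat_size[of "a + b"]) auto
    moreover have "flat_size (a + b) < ?n"
      using False flat_size_less[of "a + b" ?k] flat_size_top by simp
    ultimately show ?thesis using top le by simp
  qed
qed

lemma bisubadditive_ghw:
  assumes "rk E < card E" "\<not> (\<exists>e. matroid_coloop E indep e)"
  shows "bisubadditive (card E - rk E) (card E) ghw"
proof
  show "ghw (card E - rk E) = card E" by (rule ghw_top_no_coloops[OF assms(2)])
  then show "card E + ghw (i + j - (card E - rk E)) \<le> ghw i + ghw j"
    if "i \<le> card E - rk E" "j \<le> card E - rk E" "card E - rk E \<le> i + j" for i j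
    using that by (rule ghw_cosubadditive)
  show "ghw i \<le> ghw j" if "i \<le> j" "j \<le> card E - rk E" for i j
    using ghw_strict_mono[of i j] that by (cases "i = j") auto
qed (use assms ghw_subadditive in auto)

text \<open>A set with one element more than a flat of rank \<open>i\<close> has rank above \<open>i\<close>, hence at most the nullity
  of that flat, so the flat would be a smaller set to choose.\<close>

lemma ghw_neq_Suc_flat_size:
  assumes "j \<le> card E - rk E" "i < rk E" shows "ghw j \<noteq> Suc (flat_size i)"
proof
  assume eq: "ghw j = Suc (flat_size i)"
  obtain a where a: "a \<le> rk E" "ghw j = j + a" "ghw j \<le> flat_size a" using ghw_rank[OF assms(1)] by blast
  have "i < a"
  proof (rule ccontr)
    assume "\<not> i < a"
    then show False using flat_size_mono[of a i] a eq assms by simp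
  qed
  then have "ghw j \<le> flat_size i"
    using a eq assms by (intro ghw_le_of_flat_size[of i]) auto
  then show False using eq by simp
qed

text \<open>Wei duality by counting: with \<open>n = card E\<close> and \<open>k = rk E\<close>, the
  \<open>n - k\<close> removed numbers and the \<open>k\<close> numbers
  \<open>n - flat_size i\<close> are disjoint in \<open>{1..n}\<close>, so they partition
  it.\<close>

lemma wei_dual_ghw:
  "wei_dual (card E) (card E - rk E) ghw = map (\<lambda>i. card E - flat_size (rk E - Suc i)) [0..<rk E]"
proof -
  let ?k = "rk E" and ?n = "card E"
  have kn: "?k \<le> ?n" by (rule rank_le_card) simp
  let ?S = "{?n + 1 - ghw j | j. j \<in> {1..?n - ?k}}" and ?T = "(\<lambda>i. ?n - flat_size i) ` {..<?k}"
  have S_img: "?S = (\<lambda>j. ?n + 1 - ghw j) ` {1..?n - ?k}" by blast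
  have ghw_pos: "1 \<le> ghw j" "ghw j \<le> ?n" if "j \<in> {1..?n - ?k}" for j
    using that ghw_strict_mono[of 0 j] ghw_le_ground[of j] by auto
  have fs: "flat_size i < ?n" if "i < ?k" for i using flat_size_less[of i ?k] flat_size_top that by simp
  have injS: "inj_on (\<lambda>j. ?n + 1 - ghw j) {1..?n - ?k}"
  proof (rule linorder_inj_onI)
    fix x y assume xy: "x < y" "x \<in> {1..?n - ?k}" "y \<in> {1..?n - ?k}"
    then have "ghw x < ghw y" by (intro ghw_strict_mono) auto
    then show "?n + 1 - ghw x \<noteq> ?n + 1 - ghw y" using ghw_pos[OF xy(3)] by simp
  qed auto
  have injT: "inj_on (\<lambda>i. ?n - flat_size i) {..<?k}"
  proof (rule linorder_inj_onI)
    fix x y assume xy: "x < y" "x \<in> {..<?k}" "y \<in> {..<?k}"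
    then show "?n - flat_size x \<noteq> ?n - flat_size y"
      using flat_size_less[of x y] fs[of y] by simp
  qed auto
  have "?T \<inter> ?S = {}"
  proof (rule ccontr)
    assume "?T \<inter> ?S \<noteq> {}"
    then obtain i j where ij: "i < ?k" "j \<in> {1..?n - ?k}" "?n - flat_size i = ?n + 1 - ghw j" by auto
    then have "ghw j = Suc (flat_size i)" using fs[of i] ghw_pos[of j] by simp
    with ij ghw_neq_Suc_flat_size[of j i] show False by simp
  qed
  moreover have "?T \<subseteq> {1..?n}" using fs by fastforce
  ultimately have "?T \<subseteq> {1..?n} - ?S" by blast
  moreover have "card ({1..?n} - ?S) = card ?T"
  proof -
    have "?S \<subseteq> {1..?n}" using ghw_pos by fastforce
    moreover have "card ?S = ?n - ?k" unfolding S_img by (subst card_image[OF injS]) simp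
    ultimately have "card ({1..?n} - ?S) = ?n - (?n - ?k)"
      by (subst card_Diff_subset) (auto dest: finite_subset)
    then show ?thesis using kn by (simp add: card_image[OF injT])
  qed
  ultimately have eq: "{1..?n} - ?S = ?T"
    using card_subset_eq[of "{1..?n} - ?S" ?T] finite_Diff[OF finite_atLeastAtMost, of 1 ?n ?S] by simp
  \<comment> \<open>Flat sizes increase, so counting ranks down from \<open>?k - 1\<close> lists
    their complements in increasing order; position \<open>i\<close> holds the dual weight of index
    \<open>i + 1\<close>.\<close>
  let ?xs = "map (\<lambda>i. ?n - flat_size (?k - Suc i)) [0..<?k]"
  have "set ?xs = ?T"
  proof -
    have "(\<lambda>i. ?k - Suc i) ` {0..<?k} = {..<?k}"
    proof
      show "{..<?k} \<subseteq> (\<lambda>i. ?k - Suc i) ` {0..<?k}"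
      proof
        fix i assume "i \<in> {..<?k}"
        then show "i \<in> (\<lambda>i. ?k - Suc i) ` {0..<?k}" by (intro image_eqI[of _ _ "?k - Suc i"]) auto
      qed
    qed auto
    then have "?T = (\<lambda>i. ?n - flat_size i) ` (\<lambda>i. ?k - Suc i) ` {0..<?k}" by simp
    then show ?thesis by (simp add: image_image)
  qed
  moreover have "sorted_wrt (<) ?xs"
  proof (subst sorted_wrt_iff_nth_less, intro allI impI)
    fix i j assume ij: "i < j" "j < length ?xs"
    then have "flat_size (?k - Suc j) < flat_size (?k - Suc i)" by (intro flat_size_less) auto
    then show "?xs ! i < ?xs ! j" using ij fs[of "?k - Suc i"] by simp
  qed
  ultimately show ?thesis
    unfolding wei_dual_def eq by (metis sorted_list_of_set.idem_if_sorted_distinct strict_sorted_iff)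
qed

text \<open>By \<open>wei_dual_ghw\<close> and \<open>dual_ghw\<close> the Wei dual lists the
  weights of the dual matroid, whose subadditivity is already known.\<close>

lemma cosubadditive_ghw:
  assumes "0 < rk E" shows "cosubadditive (card E) (card E - rk E) ghw"
proof -
  interpret dual: bisubadditive "rk E" "card E" "gen_hamming_weight E (matroid_dual E indep)"
    by (rule dual_bisubadditive[OF assms])
  let ?xs = "wei_dual (card E) (card E - rk E) ghw"
  have "?xs ! (i - 1) = gen_hamming_weight E (matroid_dual E indep) i" if i: "i \<in> {1..rk E}" for i
  proof -
    obtain i' where "i = Suc i'" using i by (cases i) auto
    then show ?thesis using i by (simp add: wei_dual_ghw dual_ghw)
  qed
  moreover have "length ?xs = rk E" by (simp add: wei_dual_ghw)
  ultimately show ?thesis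
    unfolding cosubadditive_def subadditive_def using dual.sub by auto
qed

end

theorem theorem6p8:
  fixes E :: "'e set" and M :: "'e set \<Rightarrow> bool" and n k :: nat
  assumes pmd: "perfect_matroid_design E M"
    and n: "n = card E"
    and k: "k = matroid_rank M E" "k \<in> {1..n - 1}"
    and no_loops: "\<not> (\<exists>e. matroid_loop E M e)"
    and no_coloops: "\<not> (\<exists>e. matroid_coloop E M e)"
  shows
    "(subadditive (n - k) (gen_hamming_weight E M) \<and>
      cosubadditive n (n - k) (gen_hamming_weight E M))
   \<and> ((\<forall>s q r. r \<in> {1..n - k} \<and> s = (n - k) * q + r \<longrightarrow>
         initial_degree (sr_symbolic_power E M s :: ('e, 'l::field) mpoly set)
           = q * gen_hamming_weight E M (n - k) + gen_hamming_weight E M r \<and>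
         q * gen_hamming_weight E M (n - k) + gen_hamming_weight E M r
           = q * n + gen_hamming_weight E M r) \<and>
      (\<lambda>s. real (initial_degree (sr_symbolic_power E M s :: ('e, 'l) mpoly set)) / real s)
        \<longlonglongrightarrow> real n / real (n - k))
   \<and> ((\<forall>s q r. r \<in> {1..k} \<and> s = k * q + r \<longrightarrow>
         initial_degree (sr_symbolic_power E (matroid_dual E M) s :: ('e, 'l) mpoly set)
           = q * gen_hamming_weight E (matroid_dual E M) k
             + gen_hamming_weight E (matroid_dual E M) r \<and>
         q * gen_hamming_weight E (matroid_dual E M) k + gen_hamming_weight E (matroid_dual E M) r
           = q * n + gen_hamming_weight E (matroid_dual E M) r) \<and>
      (\<lambda>s. real (initial_degree
              (sr_symbolic_power E (matroid_dual E M) s :: ('e, 'l) mpoly set)) / real s)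
        \<longlonglongrightarrow> real n / real k)"
proof -
  interpret matroid E M using pmd by (simp add: perfect_matroid_design_def)
  interpret loopless_matroid_design E M by unfold_locales (fact pmd no_loops)+
  interpret dual: matroid E "matroid_dual E M" by (rule matroid_dual)
  interpret bM: bisubadditive "n - k" n ghw
    using bisubadditive_ghw no_coloops k n by auto
  interpret bD: bisubadditive k n dual.ghw
    using dual_bisubadditive k n by auto
  \<comment> \<open>The dual has corank \<open>k\<close>, so the general degree formula applies to
    it with period \<open>k\<close>.\<close>
  have "card E - dual.rk E = k" using dual_nullity[of E] k by simp
  then have dD: "initial_degree (sr_symbolic_power E (matroid_dual E M) s :: ('e, 'l) mpoly set) = bD.D s" for s
    using dual.initial_degree_symbolic_power bD.bisubadditive_axioms n by metis
  have dM: "initial_degree (sr_symbolic_power E M s :: ('e, 'l) mpoly set) = bM.D s" for s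
    using initial_degree_symbolic_power bM.bisubadditive_axioms n k by metis
  have "cosubadditive n (n - k) ghw" using cosubadditive_ghw k n by simp
  moreover have "subadditive (n - k) ghw" unfolding subadditive_def using bM.sub by simp
  ultimately show ?thesis
    unfolding dD dM using bM.extension_average bD.extension_average
    by (simp add: bM.extension_eq bD.extension_eq bM.top bD.top)
qed

end
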